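(* Let $(V,\sigma)$ be a pre-braided vector space over a field $\Bbbk$. (1) For braided characters $\epsilon$ and $\zeta$, the maps $V^{\otimes n}\to V^{\otimes (n-1)}$, $1\le i\le n$, $$d_{n;i}=\epsilon_1\circ T^{\sigma}_{p_{i,n}},\qquad d'_{n;i}=\zeta_n\circ T^{\sigma}_{p'_{i,n}}$$ define a pre-bisimplicial structure on $(V^{\otimes n})_{n\ge0}$, where $p_{i,n}\in S_n$ (resp. $p'_{i,n}\in S_n$) is the permutation moving the $i$-th element to the leftmost (resp. rightmost) position and preserving the order of the others. (2) The total differentials $\partial_n=\sum_{i=1}^n(-1)^{i-1}d_{n;i}$ and $\partial'_n=\sum_{i=1}^n(-1)^{i-1}d'_{n;i}$ coincide respectively with ${}^{\epsilon}d=\epsilon_1\circ\mathrm{csh}_{-\sigma}^{1,n-1}$ and $d^{\zeta}=(-1)^{n-1}\zeta_n\circ\mathrm{csh}_{-\sigma}^{n-1,1}$ on $V^{\otimes n}$. (3) If $\epsilon$ and $\zeta$ are moreover $\sigma$-compatible, then the maps $\epsilon_1\circ T^{\sigma}_{p_{i,n}}$ and the maps $\zeta_1\circ T^{\sigma}_{p_{i,n}}$ together define a pre-bisimplicial structure on $(V^{\otimes n})_{n\ge 0}$. (4) If $\Delta:V\to V\otimes V$ is such that $(V,\sigma,\Delta)$ is a pre-braided coalgebra, then the maps $s_{n;i}:=\Delta_i:V^{\otimes n}\to V^{\otimes(n+1)}$, $1\le i\le n$, complete the pre-bisimplicial structures of (1) and (3) into very weakly bisimplicial ones. (5) If $(V,\sigma,\Delta)$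 is only a semi-pre-braided coalgebra, then $(V^{\otimes n},d_{n;i},s_{n;i})$ is a very weakly simplicial vector space. (6) If $\Delta$ is moreover $\sigma$-cocommutative, then the structures of (4) (resp. (5)) are weakly bisimplicial (resp. weakly simplicial).
   Context: All tensor products are over $\Bbbk$, $V^{\otimes 0}=\Bbbk$. A pre-braiding on $V$ is a linear map $\sigma:V\otimes V\to V\otimes V$ (not necessarily invertible) with $\sigma_1\sigma_2\sigma_1=\sigma_2\sigma_1\sigma_2$ on $V^{\otimes 3}$, where for a linear map $\varphi:V^{\otimes l}\to V^{\otimes r}$, $\varphi_i=\mathrm{Id}_{V^{\otimes(i-1)}}\otimes\varphi\otimes\mathrm{Id}$. A pair $(V,\sigma)$ is then called a pre-braided vector space; $-\sigma$ is also a pre-braiding. For a pre-braiding $\beta$ and $s\in S_n$ with a shortest expression $s=\tau_{i_1}\cdots\tau_{i_k}$ in adjacent transpositions $\tau_i=(i\ i{+}1)$, $T_s^{\beta}=\beta_{i_1}\circ\cdots\circ\beta_{i_k}$ on $V^{\otimes n}$ (well defined). Explicitly $T^{\sigma}_{p_{i,n}}=\sigma_1\circ\sigma_2\circ\cdots\circ\sigma_{i-1}$ and $T^{\sigma}_{p'_{i,n}}=\sigma_{n-1}\circ\cdots\circ\sigma_{i+1}\circ\sigma_i$. With $Sh_{p,q}=\{s\in S_{p+q}: s(1)<\dots<s(p),\ s(p+1)<\dots<s(p+q)\}$, put $\mathrm{csh}_{\beta}^{p,q}=\sum_{s\in Sh_{p,q}}T^{\beta}_{s^{-1}}$. A braided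 character is $\epsilon\in V^*$ with $(\epsilon\otimes\epsilon)\circ\sigma=\epsilon\otimes\epsilon$. Elements $f,g\in V^*$ are $\sigma$-compatible if $(f\otimes g)\circ\sigma=g\otimes f$ and $(g\otimes f)\circ\sigma=f\otimes g$. $(V,\sigma,\Delta)$ is a pre-braided coalgebra if $\Delta$ is coassociative, $\Delta_2\circ\sigma=\sigma_1\circ\sigma_2\circ\Delta_1$ and $\Delta_1\circ\sigma=\sigma_2\circ\sigma_1\circ\Delta_2$ (maps $V^{\otimes2}\to V^{\otimes 3}$); it is a semi-pre-braided coalgebra if $\Delta$ is coassociative and the first of these two identities holds. It is $\sigma$-cocommutative if $\sigma\circ\Delta=\Delta$. Simplicial vocabulary, for vector spaces $V_n$ ($n\ge0$) with linear maps $d_{n;i},d'_{n;i}:V_n\to V_{n-1}$, $s_{n;i}:V_n\to V_{n+1}$, $1\le i\le n$ (first subscripts omitted, the source of all composites being $V_n$): presimplicial: $d_id_j=d_{j-1}d_i$ for $1\le i<j\le n$; very weakly simplicial: moreover $s_is_j=s_{j+1}s_i$ for $1\le i\le j\le n$, $d_is_j=s_{j-1}d_i$ for $1\le i<j\le n$, $d_is_j=s_jd_{i-1}$ for $1\le j$, $j+1<i\le n+1$; weakly simplicial: moreover $d_is_i=d_{i+1}s_i$ for $1\le i\le n$; pre-bisimplicial: $(V_n,d)$ and $(V_n,d')$ are presimplicial and $d_id'_j=d'_{j-1}d_i$, $d'_id_j=d_{j-1}d'_i$ for $1\le i<j\le n$; (very) weakly bisimplicial: pre-bisimplicial with both $(V_n,d,s)$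 and $(V_n,d',s)$ (very) weakly simplicial. *)

theory Defs
  imports
    Complex_Main
    "HOL-Library.Function_Algebras"
    "HOL-Combinatorics.Permutations"
begin

section \<open>Tensor powers\<close>

text \<open>
  The vector space V is a type \<open>'v\<close> together with a scalar multiplication \<open>scale\<close> by a field
  \<open>'k\<close>.  A form \<open>f\<close> on lists encodes a family of n-linear forms, one for each n, by its values
  on the lists of length n.  The pure tensor of a list is the evaluation of such families at
  this list, and the n-th tensor power is the span of the pure tensors of lists of length n.
  Since V has a basis, this is a tensor power in the usual sense: see \<open>tpow_universal\<close> and
  \<open>tpow_eqI\<close> below for the universal property.  Functions on tensors matter only on the
  tensor power that is their intended domain.
\<close>

type_synonym ('k, 'v) tensor = "('v list \<Rightarrow> 'k) \<Rightarrow> 'k"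

definition multilinear :: "('k::field \<Rightarrow> 'v::ab_group_add \<Rightarrow> 'v) \<Rightarrow> ('v list \<Rightarrow> 'k) \<Rightarrow> bool" where
  "multilinear scale f \<longleftrightarrow>
    (\<forall>us ws. Vector_Spaces.linear scale (*) (\<lambda>v. f (us @ v # ws)))"

definition pure_tensor ::
  "('k::field \<Rightarrow> 'v::ab_group_add \<Rightarrow> 'v) \<Rightarrow> 'v list \<Rightarrow> ('k, 'v) tensor" where
  "pure_tensor scale xs = (\<lambda>f. if multilinear scale f then f xs else 0)"

definition tscale :: "'k::field \<Rightarrow> ('k, 'v) tensor \<Rightarrow> ('k, 'v) tensor" where
  "tscale c t = (\<lambda>f. c * t f)"

definition tpow ::
  "('k::field \<Rightarrow> 'v::ab_group_add \<Rightarrow> 'v) \<Rightarrow> nat \<Rightarrow> ('k, 'v) tensor set" where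
  "tpow scale n = module.span tscale (pure_tensor scale ` {xs. length xs = n})"

text \<open>The product of tensors; on pure tensors it is concatenation (\<open>tprod_pure\<close>).\<close>

definition tprod ::
  "('k::field \<Rightarrow> 'v::ab_group_add \<Rightarrow> 'v) \<Rightarrow> ('k, 'v) tensor \<Rightarrow> ('k, 'v) tensor \<Rightarrow> ('k, 'v) tensor" where
  "tprod scale s t =
    (\<lambda>f. if multilinear scale f then s (\<lambda>us. t (\<lambda>ws. f (us @ ws))) else 0)"

text \<open>
  For \<open>g\<close> multilinear on lists of length \<open>n\<close> with values in a tensor power, \<open>tlift n g\<close> is the
  linear map on the n-th tensor power sending the pure tensor of \<open>xs\<close> to \<open>g xs\<close>
  (\<open>tlift_pure\<close>).
\<close>

definition tlift :: "nat \<Rightarrow> ('v list \<Rightarrow> ('k::field, 'v) tensor) \<Rightarrow> ('k, 'v) tensor \<Rightarrow> ('k, 'v) tensor" where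
  "tlift n g t = (\<lambda>f. t (\<lambda>xs. if length xs = n then g xs f else 0))"

text \<open>
  For \<open>\<phi>\<close> defined on the l-th tensor power, \<open>act_at scale l n i \<phi>\<close> is the map
  \<open>\<phi>\<^sub>i = Id \<otimes> \<phi> \<otimes> Id\<close> on the n-th tensor power, with \<open>i - 1\<close> identity factors on the left
  (\<open>act_at_pure\<close>); it is meant for \<open>1 \<le> i\<close> and \<open>i + l \<le> n + 1\<close>.
\<close>

definition act_at ::
  "('k::field \<Rightarrow> 'v::ab_group_add \<Rightarrow> 'v) \<Rightarrow> nat \<Rightarrow> nat \<Rightarrow> nat \<Rightarrow>
    (('k, 'v) tensor \<Rightarrow> ('k, 'v) tensor) \<Rightarrow> ('k, 'v) tensor \<Rightarrow> ('k, 'v) tensor" where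
  "act_at scale l n i \<phi> =
    tlift n (\<lambda>xs. tprod scale (pure_tensor scale (take (i - 1) xs))
      (tprod scale (\<phi> (pure_tensor scale (take l (drop (i - 1) xs))))
        (pure_tensor scale (drop (i - 1 + l) xs))))"

text \<open>
  Maps out of V, seen as maps out of the first tensor power; the field is identified with the
  zeroth tensor power, with \<open>1\<close> corresponding to the pure tensor of the empty list.
\<close>

definition form_map ::
  "('k::field \<Rightarrow> 'v::ab_group_add \<Rightarrow> 'v) \<Rightarrow> ('v \<Rightarrow> 'k) \<Rightarrow> ('k, 'v) tensor \<Rightarrow> ('k, 'v) tensor" where
  "form_map scale \<epsilon> = tlift 1 (\<lambda>xs. tscale (\<epsilon> (hd xs)) (pure_tensor scale []))"

definition comult_map :: "('v \<Rightarrow> ('k::field, 'v) tensor) \<Rightarrow> ('k, 'v) tensor \<Rightarrow> ('k, 'v) tensor" where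
  "comult_map \<Delta> = tlift 1 (\<lambda>xs. \<Delta> (hd xs))"

text \<open>The linear form \<open>f \<otimes> g\<close> on the second tensor power.\<close>

definition form_prod :: "('v \<Rightarrow> 'k::field) \<Rightarrow> ('v \<Rightarrow> 'k) \<Rightarrow> ('k, 'v) tensor \<Rightarrow> 'k" where
  "form_prod f g t = t (\<lambda>xs. if length xs = 2 then f (xs ! 0) * g (xs ! 1) else 0)"

definition linear_between ::
  "('k::field \<Rightarrow> 'a::ab_group_add \<Rightarrow> 'a) \<Rightarrow> 'a set \<Rightarrow> 'a set \<Rightarrow> ('a \<Rightarrow> 'a) \<Rightarrow> bool" where
  "linear_between sc A B f \<longleftrightarrow>
    f ` A \<subseteq> B \<and>
    (\<forall>x\<in>A. \<forall>y\<in>A. f (x + y) = f x + f y) \<and>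
    (\<forall>c. \<forall>x\<in>A. f (sc c x) = sc c (f x))"


subsection \<open>Basic facts and the universal property\<close>

lemma vector_space_tscale: "vector_space (tscale :: 'k::field \<Rightarrow> ('k, 'v) tensor \<Rightarrow> _)"
  by unfold_locales (auto simp: tscale_def fun_eq_iff algebra_simps)

lemma vector_space_times: "vector_space ((*) :: 'k::field \<Rightarrow> 'k \<Rightarrow> 'k)"
  by unfold_locales (auto simp: algebra_simps)

lemma linear_pure_tensor:
  fixes scale :: "'k::field \<Rightarrow> 'v::ab_group_add \<Rightarrow> 'v"
  assumes "vector_space scale"
  shows "Vector_Spaces.linear scale tscale (\<lambda>v. pure_tensor scale (us @ v # ws))"
proof -
  have "f (us @ scale a v # ws) = a * f (us @ v # ws)"
    "f (us @ (v + w) # ws) = f (us @ v # ws) + f (us @ w # ws)"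
    if "multilinear scale f" for f a v w
    using that by (auto simp: multilinear_def Vector_Spaces.linear_iff)
  then show ?thesis
    using assms vector_space_tscale
    by (auto simp: Vector_Spaces.linear_iff pure_tensor_def tscale_def fun_eq_iff)
qed

lemma pure_in_tpow:
  fixes scale :: "'k::field \<Rightarrow> 'v::ab_group_add \<Rightarrow> 'v"
  assumes "length xs = n"
  shows "pure_tensor scale xs \<in> tpow scale n"
proof -
  interpret T: vector_space "tscale :: 'k \<Rightarrow> ('k, 'v) tensor \<Rightarrow> _" by (rule vector_space_tscale)
  show ?thesis unfolding tpow_def using assms by (intro T.span_base) auto
qed

lemma tpow_eqI:
  fixes scale :: "'k::field \<Rightarrow> 'v::ab_group_add \<Rightarrow> 'v" and sW :: "'k \<Rightarrow> 'w::ab_group_add \<Rightarrow> 'w"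
  assumes "Vector_Spaces.linear tscale sW h" "Vector_Spaces.linear tscale sW h'"
    and "\<And>xs. length xs = n \<Longrightarrow> h (pure_tensor scale xs) = h' (pure_tensor scale xs)"
    and "t \<in> tpow scale n"
  shows "h t = h' t"
proof -
  interpret vector_space_pair "tscale :: 'k \<Rightarrow> ('k, 'v) tensor \<Rightarrow> _" sW
    using assms(1) unfolding Vector_Spaces.linear_iff vector_space_pair_def by blast
  have "t \<in> vs1.span (pure_tensor scale ` {xs. length xs = n})"
    using assms(4) unfolding tpow_def .
  then show ?thesis
    by (rule linear_eq_on_span[OF assms(1,2), rotated]) (use assms(3) in blast)
qed

lemma tpow_universal:
  fixes scale :: "'k::field \<Rightarrow> 'v::ab_group_add \<Rightarrow> 'v" and sW :: "'k \<Rightarrow> 'w::ab_group_add \<Rightarrow> 'w"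
  assumes "vector_space scale" and W: "vector_space sW"
    and g: "\<And>us ws. length us + 1 + length ws = n \<Longrightarrow>
      Vector_Spaces.linear scale sW (\<lambda>v. g (us @ v # ws))"
  shows "\<exists>h. Vector_Spaces.linear tscale sW h \<and>
    (\<forall>xs. length xs = n \<longrightarrow> h (pure_tensor scale xs) = g xs)"
proof -
  interpret T: vector_space "tscale :: 'k \<Rightarrow> ('k, 'v) tensor \<Rightarrow> _" by (rule vector_space_tscale)
  interpret W: vector_space sW by (rule W)
  interpret TW: vector_space_pair "tscale :: 'k \<Rightarrow> ('k, 'v) tensor \<Rightarrow> _" sW ..
  interpret WK: vector_space_pair sW "(*)"
    by (intro vector_space_pair.intro W vector_space_times)
  let ?P = "pure_tensor scale ` {xs. length xs = n}"
  obtain B where B: "B \<subseteq> ?P" "T.independent B" "?P \<subseteq> T.span B"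
    using T.maximal_independent_subset[of ?P] .
  have "\<forall>b\<in>B. \<exists>xs. length xs = n \<and> b = pure_tensor scale xs" using B(1) by auto
  then obtain r where r: "\<And>b. b \<in> B \<Longrightarrow> length (r b) = n"
      "\<And>b. b \<in> B \<Longrightarrow> b = pure_tensor scale (r b)"
    by metis
  define h where "h = TW.construct B (\<lambda>b. g (r b))"
  have lin: "Vector_Spaces.linear tscale sW h"
    unfolding h_def by (rule TW.linear_construct[OF B(2)])
  have hb: "h b = g (r b)" if "b \<in> B" for b
    unfolding h_def by (rule TW.construct_basis[OF B(2) that])
  have "h (pure_tensor scale xs) = g xs" if xs: "length xs = n" for xs
  proof (rule ccontr)
    assume neq: "h (pure_tensor scale xs) \<noteq> g xs"
    have "pure_tensor scale xs \<in> T.span B" using B(3) xs by auto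
    then obtain F c where F: "finite F" "F \<subseteq> B"
      and eq: "pure_tensor scale xs = (\<Sum>b\<in>F. tscale (c b) b)"
      unfolding T.span_explicit by auto
    have hx: "h (pure_tensor scale xs) = (\<Sum>b\<in>F. sW (c b) (g (r b)))"
      unfolding eq TW.linear_sum[OF lin] TW.linear_scale[OF lin] using F(2) hb
      by (intro sum.cong) auto
    define y where "y = g xs - h (pure_tensor scale xs)"
    have "y \<noteq> 0" using neq by (simp add: y_def)
    then have "W.independent {y}" by (simp add: W.dependent_single)
    then obtain l where l: "Vector_Spaces.linear sW (*) l" "l y = 1"
      using WK.linear_independent_extend[of "{y}" "\<lambda>_. 1"] by auto
    define f where "f zs = (if length zs = n then l (g zs) else 0)" for zs
    have "multilinear scale f"
      unfolding multilinear_def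
    proof (intro allI)
      fix us ws :: "'v list"
      show "Vector_Spaces.linear scale (*) (\<lambda>v. f (us @ v # ws))"
      proof (cases "length us + 1 + length ws = n")
        case True
        then have "(\<lambda>v. f (us @ v # ws)) = l \<circ> (\<lambda>v. g (us @ v # ws))"
          by (auto simp: f_def fun_eq_iff)
        then show ?thesis
          using Vector_Spaces.linear_compose[OF g[OF True] l(1)] by simp
      next
        case False
        then have "(\<lambda>v. f (us @ v # ws)) = (\<lambda>v. 0)" by (auto simp: f_def fun_eq_iff)
        then show ?thesis
          using assms(1) vector_space_times by (simp add: Vector_Spaces.linear_iff)
      qed
    qed
    then have pf: "pure_tensor scale zs f = f zs" for zs by (simp add: pure_tensor_def)
    have "l (g xs) = pure_tensor scale xs f" using xs by (simp add: pf f_def)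
    also have "\<dots> = (\<Sum>b\<in>F. c b * b f)"
      unfolding eq using F(1) by (induction F) (auto simp: tscale_def)
    also have "\<dots> = (\<Sum>b\<in>F. c b * l (g (r b)))"
    proof (intro sum.cong refl)
      fix b assume "b \<in> F"
      then have b: "b \<in> B" using F(2) by auto
      then have "b f = f (r b)" using r(2) pf by metis
      then show "c b * b f = c b * l (g (r b))" using r(1)[OF b] by (simp add: f_def)
    qed
    also have "\<dots> = l (h (pure_tensor scale xs))"
      unfolding hx WK.linear_sum[OF l(1)] WK.linear_scale[OF l(1)] ..
    finally have "l y = 0" unfolding y_def WK.linear_diff[OF l(1)] by simp
    with l(2) show False by simp
  qed
  with lin show ?thesis by blast
qed

lemma multilinear_append:
  assumes "multilinear scale f"
  shows "multilinear scale (\<lambda>ws. f (us @ ws))" "multilinear scale (\<lambda>us. f (us @ ws))"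
  unfolding multilinear_def
proof (safe)
  fix as bs
  show "Vector_Spaces.linear scale (*) (\<lambda>v. f (us @ as @ v # bs))"
    using assms[unfolded multilinear_def, rule_format, of "us @ as" bs] by simp
  show "Vector_Spaces.linear scale (*) (\<lambda>v. f ((as @ v # bs) @ ws))"
    using assms[unfolded multilinear_def, rule_format, of as "bs @ ws"] by simp
qed

lemma tprod_pure:
  "tprod scale (pure_tensor scale us) (pure_tensor scale ws) = pure_tensor scale (us @ ws)"
  by (auto simp: tprod_def pure_tensor_def fun_eq_iff multilinear_append)

lemma tlift_pure:
  fixes scale :: "'k::field \<Rightarrow> 'v::ab_group_add \<Rightarrow> 'v"
  assumes V: "vector_space scale"
    and g: "\<And>us ws. length us + 1 + length ws = n \<Longrightarrow>
      Vector_Spaces.linear scale tscale (\<lambda>v. g (us @ v # ws))"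
    and xs: "length xs = n"
  shows "tlift n g (pure_tensor scale xs) = g xs"
proof
  fix f
  have "multilinear scale (\<lambda>xs. if length xs = n then g xs f else 0)" (is "multilinear scale ?f")
    unfolding multilinear_def
  proof (intro allI)
    fix us ws :: "'v list"
    show "Vector_Spaces.linear scale (*) (\<lambda>v. ?f (us @ v # ws))"
    proof (cases "length us + 1 + length ws = n")
      case True
      show ?thesis
        using g[OF True] True vector_space_times
        by (auto simp: Vector_Spaces.linear_iff tscale_def)
    next
      case False
      then show ?thesis using V vector_space_times by (auto simp: Vector_Spaces.linear_iff)
    qed
  qed
  then show "tlift n g (pure_tensor scale xs) f = g xs f"
    using xs by (simp add: tlift_def pure_tensor_def)
qed

lemma tpow_eval:
  fixes t :: "('k::field, 'v::ab_group_add) tensor"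
  assumes "t \<in> tpow scale n"
  obtains F c where "finite F"
    "\<And>f. t f = (if multilinear scale f then \<Sum>xs\<in>F. c xs * f xs else 0)"
proof -
  interpret T: vector_space "tscale :: 'k \<Rightarrow> ('k, 'v) tensor \<Rightarrow> _" by (rule vector_space_tscale)
  obtain S c where S: "finite S" "S \<subseteq> pure_tensor scale ` {xs. length xs = n}"
    and t: "t = (\<Sum>b\<in>S. tscale (c b) b)"
    using assms unfolding tpow_def T.span_explicit by auto
  obtain F where F: "inj_on (pure_tensor scale) F" "pure_tensor scale ` F = S"
    using S(2) by (metis subset_image_inj)
  have fin: "finite F" using F S(1) finite_image_iff by blast
  have "t = (\<Sum>xs\<in>F. tscale (c (pure_tensor scale xs)) (pure_tensor scale xs))"
    unfolding t F(2)[symmetric] sum.reindex[OF F(1)] by simp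
  moreover have "(\<Sum>xs\<in>F. tscale (c (pure_tensor scale xs)) (pure_tensor scale xs)) f =
      (\<Sum>xs\<in>F. c (pure_tensor scale xs) * pure_tensor scale xs f)" for f
    using fin by (induction F) (auto simp: tscale_def)
  ultimately have "t f = (\<Sum>xs\<in>F. c (pure_tensor scale xs) * pure_tensor scale xs f)" for f
    by simp
  then show thesis
    using fin by (intro that[of F "\<lambda>xs. c (pure_tensor scale xs)"]) (auto simp: pure_tensor_def)
qed

lemma tprod_add_left: "tprod scale (s + s') t = tprod scale s t + tprod scale s' t"
  by (auto simp: tprod_def fun_eq_iff)

lemma tprod_scale_left: "tprod scale (tscale c s) t = tscale c (tprod scale s t)"
  by (auto simp: tprod_def tscale_def fun_eq_iff)

lemma multilinear_tpow:
  assumes "vector_space scale" "t \<in> tpow scale n" "multilinear scale f"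
  shows "multilinear scale (\<lambda>us. t (\<lambda>ws. f (us @ ws)))"
proof -
  obtain F c where F: "finite F"
    "\<And>f. t f = (if multilinear scale f then \<Sum>xs\<in>F. c xs * f xs else 0)"
    using tpow_eval[OF assms(2)] by metis
  have add: "f (us @ scale a v # ws) = a * f (us @ v # ws)"
      "f (us @ (v + w) # ws) = f (us @ v # ws) + f (us @ w # ws)" for us ws v w a
    using assms(3) by (auto simp: multilinear_def Vector_Spaces.linear_iff)
  have "t (\<lambda>ws. f (us @ ws)) = (\<Sum>xs\<in>F. c xs * f (us @ xs))" for us
    unfolding F(2) using multilinear_append(1)[OF assms(3)] by simp
  moreover have "f ((as @ (v + w) # bs) @ xs) = f ((as @ v # bs) @ xs) + f ((as @ w # bs) @ xs)"
    "f ((as @ scale a v # bs) @ xs) = a * f ((as @ v # bs) @ xs)" for as bs v w a xs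
    using add[of as _ _ "bs @ xs"] by simp_all
  ultimately show ?thesis
    using assms(1) vector_space_times
    by (simp only: multilinear_def Vector_Spaces.linear_iff sum.distrib distrib_left
        sum_distrib_left mult.left_commute simp_thms)
qed

lemma tprod_linear_right:
  fixes scale :: "'k::field \<Rightarrow> 'v::ab_group_add \<Rightarrow> 'v"
  assumes V: "vector_space scale" and s: "s \<in> tpow scale m"
    and t: "t \<in> tpow scale n" "t' \<in> tpow scale n"
  shows "tprod scale s (t + t') = tprod scale s t + tprod scale s t'"
    and "tprod scale s (tscale a t) = tscale a (tprod scale s t)"
proof -
  obtain F c where F: "finite F"
    "\<And>f. s f = (if multilinear scale f then \<Sum>xs\<in>F. c xs * f xs else 0)"
    using tpow_eval[OF s] by metis
  interpret T: vector_space "tscale :: 'k \<Rightarrow> ('k, 'v) tensor \<Rightarrow> _" by (rule vector_space_tscale)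
  have mem: "t + t' \<in> tpow scale n" "tscale a t \<in> tpow scale n"
    using t unfolding tpow_def by (auto intro: T.span_add T.span_scale)
  note m = multilinear_tpow[OF V mem(1)] multilinear_tpow[OF V mem(2)]
    multilinear_tpow[OF V t(1)] multilinear_tpow[OF V t(2)]
  show "tprod scale s (t + t') = tprod scale s t + tprod scale s t'"
    using m by (auto simp: fun_eq_iff tprod_def F(2) algebra_simps sum.distrib)
  show "tprod scale s (tscale a t) = tscale a (tprod scale s t)"
  proof
    fix f
    show "tprod scale s (tscale a t) f = tscale a (tprod scale s t) f"
    proof (cases "multilinear scale f")
      case True
      have "tprod scale s (tscale a t) f = (\<Sum>us\<in>F. c us * (tscale a t) (\<lambda>ws. f (us @ ws)))"
        using m(2)[OF True] by (simp only: tprod_def F(2) True if_True)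
      also have "\<dots> = (\<Sum>us\<in>F. a * (c us * t (\<lambda>ws. f (us @ ws))))"
        by (simp only: tscale_def mult.left_commute)
      also have "\<dots> = tscale a (tprod scale s t) f"
        using m(3)[OF True] by (simp only: tscale_def tprod_def F(2) True if_True sum_distrib_left)
      finally show ?thesis .
    qed (simp add: tprod_def tscale_def)
  qed
qed

lemma tprod_in_tpow:
  fixes scale :: "'k::field \<Rightarrow> 'v::ab_group_add \<Rightarrow> 'v"
  assumes V: "vector_space scale" and s: "s \<in> tpow scale m" and t: "t \<in> tpow scale n"
  shows "tprod scale s t \<in> tpow scale (m + n)"
proof -
  interpret T: vector_space "tscale :: 'k \<Rightarrow> ('k, 'v) tensor \<Rightarrow> _" by (rule vector_space_tscale)
  have sub: "T.subspace (tpow scale k)" for k unfolding tpow_def by simp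
  have zero: "0 \<in> tpow scale k" for k using T.subspace_0[OF sub] .
  have pure: "tprod scale (pure_tensor scale us) t \<in> tpow scale (m + n)" if us: "length us = m" for us
  proof -
    note lin = tprod_linear_right[OF V pure_in_tpow[OF us]]
    have "t \<in> tpow scale n \<and> tprod scale (pure_tensor scale us) t \<in> tpow scale (m + n)"
      using t[unfolded tpow_def]
    proof (induction rule: T.span_induct_alt)
      case base
      have "tprod scale (pure_tensor scale us) 0 = 0"
        by (auto simp: tprod_def pure_tensor_def fun_eq_iff)
      then show ?case using zero by metis
    next
      case (step c x y)
      from step(1) obtain ws where ws: "length ws = n" "x = pure_tensor scale ws" by auto
      have x: "x \<in> tpow scale n" unfolding ws(2) by (rule pure_in_tpow[OF ws(1)])
      have cx: "tscale c x \<in> tpow scale n" using T.subspace_scale[OF sub x] .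
      have "tprod scale (pure_tensor scale us) x \<in> tpow scale (m + n)"
        unfolding ws(2) tprod_pure by (rule pure_in_tpow) (simp add: us ws(1))
      then have "tscale c (tprod scale (pure_tensor scale us) x) \<in> tpow scale (m + n)"
        by (rule T.subspace_scale[OF sub])
      moreover have y: "y \<in> tpow scale n" using step(2) by blast
      ultimately show ?case
        unfolding lin(1)[OF cx y] lin(2)[OF x x]
        using step(2) by (intro conjI T.subspace_add[OF sub] cx) blast+
    qed
    then show ?thesis ..
  qed
  show ?thesis
    using s[unfolded tpow_def]
  proof (induction rule: T.span_induct_alt)
    case base
    have "tprod scale 0 t = 0" by (auto simp: tprod_def fun_eq_iff)
    then show ?case using zero by metis
  next
    case (step c x y)
    then show ?case
      unfolding tprod_add_left tprod_scale_left
      using pure by (intro T.subspace_add[OF sub] T.subspace_scale[OF sub]) blast+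
  qed
qed

lemma linear_tlift: "Vector_Spaces.linear tscale tscale (tlift n g)"
  using vector_space_tscale
  by (auto simp: Vector_Spaces.linear_iff tlift_def tscale_def fun_eq_iff)

lemma act_at_pure:
  fixes scale :: "'k::field \<Rightarrow> 'v::ab_group_add \<Rightarrow> 'v"
  assumes V: "vector_space scale"
    and \<phi>: "linear_between tscale (tpow scale l) (tpow scale r) \<phi>"
    and len: "length us + 1 = i" "length vs = l" "length us + l + length ws = n"
  shows "act_at scale l n i \<phi> (pure_tensor scale (us @ vs @ ws)) =
    tprod scale (pure_tensor scale us) (tprod scale (\<phi> (pure_tensor scale vs)) (pure_tensor scale ws))"
proof -
  define a where "a = i - 1"
  define P where "P = pure_tensor scale"
  have mem: "P xs \<in> tpow scale (length xs)" for xs unfolding P_def by (rule pure_in_tpow) simp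
  have mem\<phi>: "\<phi> (P xs) \<in> tpow scale r" if "length xs = l" for xs
    using \<phi> mem[of xs] that by (auto simp: linear_between_def)
  note Pl = linear_pure_tensor[OF V, unfolded Vector_Spaces.linear_iff, folded P_def]
  have Padd: "P (as @ (v + w) # bs) = P (as @ v # bs) + P (as @ w # bs)" for as v w bs
    using Pl by blast
  have Psc: "P (as @ scale c v # bs) = tscale c (P (as @ v # bs))" for as c v bs
    using Pl by blast
  have \<phi>add: "\<phi> (P xs + P ys) = \<phi> (P xs) + \<phi> (P ys)" if "length xs = l" "length ys = l" for xs ys
    using \<phi> mem[of xs] mem[of ys] that by (auto simp: linear_between_def)
  have \<phi>sc: "\<phi> (tscale c (P xs)) = tscale c (\<phi> (P xs))" if "length xs = l" for xs c
    using \<phi> mem[of xs] that by (auto simp: linear_between_def)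
  let ?g = "\<lambda>xs. tprod scale (P (take a xs))
      (tprod scale (\<phi> (P (take l (drop a xs)))) (P (drop (a + l) xs)))"
  have "Vector_Spaces.linear scale tscale (\<lambda>v. ?g (as @ v # bs))"
    if n: "length as + 1 + length bs = n" for as bs
  proof -
    have al: "a + l \<le> n" using len by (simp add: a_def)
    have R: "tprod scale (\<phi> (P xs)) (P ys) \<in> tpow scale (r + length ys)"
      if "length xs = l" for xs ys
      using tprod_in_tpow[OF V mem\<phi>[OF that] mem] .
    consider "length as < a" | "a \<le> length as" "length as < a + l" | "a + l \<le> length as"
      by linarith
    then show ?thesis
    proof cases
      case 1
      then obtain d where d: "a = length as + Suc d" using less_iff_Suc_add by auto
      show ?thesis
        using V vector_space_tscale
        by (simp add: Vector_Spaces.linear_iff d Padd Psc tprod_add_left tprod_scale_left)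
    next
      case 2
      define d where "d = length as - a"
      have d: "length as = a + d" "d < l" using 2 by (auto simp: d_def)
      then obtain e where e: "l = d + Suc e" using less_iff_Suc_add by auto
      have tk: "take l (drop a (as @ v # bs)) = drop a as @ v # take e bs" for v
        using d(1) by (simp add: e)
      have tk': "drop (a + l) (as @ v # bs) = drop e bs" "take a (as @ v # bs) = take a as" for v
        using d(1) by (simp_all add: e)
      have ln: "length (drop a as @ v # take e bs) = l" for v
        using d(1) e al n by simp
      note pr = tprod_linear_right[OF V mem R[OF ln] R[OF ln]]
      show ?thesis
        using V vector_space_tscale
        unfolding Vector_Spaces.linear_iff tk tk' Padd Psc
        by (simp add: \<phi>add[OF ln ln] \<phi>sc[OF ln] tprod_add_left tprod_scale_left pr)
    next
      case 3
      then obtain d where d: "length as = a + l + d" using le_Suc_ex by auto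
      have tk: "take l (drop a (as @ v # bs)) = take l (drop a as)"
        "drop (a + l) (as @ v # bs) = drop (a + l) as @ v # bs"
        "take a (as @ v # bs) = take a as" for v
        using d by simp_all
      have ln: "length (take l (drop a as)) = l" using d by simp
      have len': "length (drop (a + l) as @ v # bs) = d + 1 + length bs" for v
        using d by simp
      note m = mem[of "drop (a + l) as @ _ # bs", unfolded len']
      note pi = tprod_linear_right[OF V mem\<phi>[OF ln] m m]
      note R' = R[OF ln, of "drop (a + l) as @ _ # bs", unfolded len']
      note po = tprod_linear_right[OF V mem R' R']
      show ?thesis
        using V vector_space_tscale
        unfolding Vector_Spaces.linear_iff tk Padd Psc pi po by simp
    qed
  qed
  moreover have "length (us @ vs @ ws) = n" using len by simp
  ultimately have "tlift n ?g (pure_tensor scale (us @ vs @ ws)) = ?g (us @ vs @ ws)"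
    by (rule tlift_pure[OF V])
  then show ?thesis
    using len by (simp add: act_at_def P_def a_def flip: len(1))
qed


section \<open>Pre-braidings and braided coalgebras\<close>

definition pre_braiding ::
  "('k::field \<Rightarrow> 'v::ab_group_add \<Rightarrow> 'v) \<Rightarrow> (('k, 'v) tensor \<Rightarrow> ('k, 'v) tensor) \<Rightarrow> bool" where
  "pre_braiding scale \<sigma> \<longleftrightarrow>
    linear_between tscale (tpow scale 2) (tpow scale 2) \<sigma> \<and>
    (let \<sigma>1 = act_at scale 2 3 1 \<sigma>; \<sigma>2 = act_at scale 2 3 2 \<sigma>
     in \<forall>t\<in>tpow scale 3. \<sigma>1 (\<sigma>2 (\<sigma>1 t)) = \<sigma>2 (\<sigma>1 (\<sigma>2 t)))"

definition braided_character ::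
  "('k::field \<Rightarrow> 'v::ab_group_add \<Rightarrow> 'v) \<Rightarrow> (('k, 'v) tensor \<Rightarrow> ('k, 'v) tensor) \<Rightarrow>
    ('v \<Rightarrow> 'k) \<Rightarrow> bool" where
  "braided_character scale \<sigma> \<epsilon> \<longleftrightarrow>
    Vector_Spaces.linear scale (*) \<epsilon> \<and>
    (\<forall>t\<in>tpow scale 2. form_prod \<epsilon> \<epsilon> (\<sigma> t) = form_prod \<epsilon> \<epsilon> t)"

definition sigma_compatible ::
  "('k::field \<Rightarrow> 'v::ab_group_add \<Rightarrow> 'v) \<Rightarrow> (('k, 'v) tensor \<Rightarrow> ('k, 'v) tensor) \<Rightarrow>
    ('v \<Rightarrow> 'k) \<Rightarrow> ('v \<Rightarrow> 'k) \<Rightarrow> bool" where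
  "sigma_compatible scale \<sigma> f g \<longleftrightarrow>
    Vector_Spaces.linear scale (*) f \<and> Vector_Spaces.linear scale (*) g \<and>
    (\<forall>t\<in>tpow scale 2. form_prod f g (\<sigma> t) = form_prod g f t) \<and>
    (\<forall>t\<in>tpow scale 2. form_prod g f (\<sigma> t) = form_prod f g t)"

definition coassociative ::
  "('k::field \<Rightarrow> 'v::ab_group_add \<Rightarrow> 'v) \<Rightarrow> ('v \<Rightarrow> ('k, 'v) tensor) \<Rightarrow> bool" where
  "coassociative scale \<Delta> \<longleftrightarrow>
    Vector_Spaces.linear scale tscale \<Delta> \<and> range \<Delta> \<subseteq> tpow scale 2 \<and>
    (\<forall>v. act_at scale 1 2 1 (comult_map \<Delta>) (\<Delta> v) = act_at scale 1 2 2 (comult_map \<Delta>) (\<Delta> v))"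

definition semi_pre_braided_coalgebra ::
  "('k::field \<Rightarrow> 'v::ab_group_add \<Rightarrow> 'v) \<Rightarrow> (('k, 'v) tensor \<Rightarrow> ('k, 'v) tensor) \<Rightarrow>
    ('v \<Rightarrow> ('k, 'v) tensor) \<Rightarrow> bool" where
  "semi_pre_braided_coalgebra scale \<sigma> \<Delta> \<longleftrightarrow>
    pre_braiding scale \<sigma> \<and> coassociative scale \<Delta> \<and>
    (\<forall>t\<in>tpow scale 2. act_at scale 1 2 2 (comult_map \<Delta>) (\<sigma> t) =
      act_at scale 2 3 1 \<sigma> (act_at scale 2 3 2 \<sigma> (act_at scale 1 2 1 (comult_map \<Delta>) t)))"

definition pre_braided_coalgebra ::
  "('k::field \<Rightarrow> 'v::ab_group_add \<Rightarrow> 'v) \<Rightarrow> (('k, 'v) tensor \<Rightarrow> ('k, 'v) tensor) \<Rightarrow>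
    ('v \<Rightarrow> ('k, 'v) tensor) \<Rightarrow> bool" where
  "pre_braided_coalgebra scale \<sigma> \<Delta> \<longleftrightarrow>
    semi_pre_braided_coalgebra scale \<sigma> \<Delta> \<and>
    (\<forall>t\<in>tpow scale 2. act_at scale 1 2 1 (comult_map \<Delta>) (\<sigma> t) =
      act_at scale 2 3 2 \<sigma> (act_at scale 2 3 1 \<sigma> (act_at scale 1 2 2 (comult_map \<Delta>) t)))"

definition sigma_cocommutative ::
  "(('k, 'v) tensor \<Rightarrow> ('k, 'v) tensor) \<Rightarrow> ('v \<Rightarrow> ('k, 'v) tensor) \<Rightarrow> bool" where
  "sigma_cocommutative \<sigma> \<Delta> \<longleftrightarrow> (\<forall>v. \<sigma> (\<Delta> v) = \<Delta> v)"


section \<open>The action of permutations and the quantum shuffles\<close>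

text \<open>
  Permutations act on positions \<open>1, \<dots>, n\<close>; a word \<open>[i\<^sub>1, \<dots>, i\<^sub>k]\<close> stands for the product
  of adjacent transpositions (rightmost factor applied first).  The map \<open>T\<close> uses some
  shortest word; by Matsumoto's theorem the choice is irrelevant when \<open>\<beta>\<close> is a pre-braiding.
\<close>

definition word_perm :: "nat list \<Rightarrow> nat \<Rightarrow> nat" where
  "word_perm w = foldr (\<lambda>i s. transpose i (i + 1) \<circ> s) w id"

definition T_perm ::
  "('k::field \<Rightarrow> 'v::ab_group_add \<Rightarrow> 'v) \<Rightarrow> (('k, 'v) tensor \<Rightarrow> ('k, 'v) tensor) \<Rightarrow> nat \<Rightarrow>
    (nat \<Rightarrow> nat) \<Rightarrow> ('k, 'v) tensor \<Rightarrow> ('k, 'v) tensor" where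
  "T_perm scale \<beta> n s =
    foldr (\<lambda>i g. act_at scale 2 n i \<beta> \<circ> g)
      (arg_min length (\<lambda>w. set w \<subseteq> {1..<n} \<and> word_perm w = s)) id"

definition Sh :: "nat \<Rightarrow> nat \<Rightarrow> (nat \<Rightarrow> nat) set" where
  "Sh p q = {s. s permutes {1..p + q} \<and> strict_mono_on {1..p} s \<and> strict_mono_on {p + 1..p + q} s}"

definition csh ::
  "('k::field \<Rightarrow> 'v::ab_group_add \<Rightarrow> 'v) \<Rightarrow> (('k, 'v) tensor \<Rightarrow> ('k, 'v) tensor) \<Rightarrow> nat \<Rightarrow> nat \<Rightarrow>
    ('k, 'v) tensor \<Rightarrow> ('k, 'v) tensor" where
  "csh scale \<beta> p q t = (\<Sum>s\<in>Sh p q. T_perm scale \<beta> (p + q) (inv s) t)"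

definition to_left :: "nat \<Rightarrow> nat \<Rightarrow> nat" where
  "to_left i = (\<lambda>j. if j = i then 1 else if 1 \<le> j \<and> j < i then j + 1 else j)"

definition to_right :: "nat \<Rightarrow> nat \<Rightarrow> nat \<Rightarrow> nat" where
  "to_right n i = (\<lambda>j. if j = i then n else if i < j \<and> j \<le> n then j - 1 else j)"

definition left_face ::
  "('k::field \<Rightarrow> 'v::ab_group_add \<Rightarrow> 'v) \<Rightarrow> (('k, 'v) tensor \<Rightarrow> ('k, 'v) tensor) \<Rightarrow>
    ('v \<Rightarrow> 'k) \<Rightarrow> nat \<Rightarrow> nat \<Rightarrow> ('k, 'v) tensor \<Rightarrow> ('k, 'v) tensor" where
  "left_face scale \<sigma> \<epsilon> n i = act_at scale 1 n 1 (form_map scale \<epsilon>) \<circ> T_perm scale \<sigma> n (to_left i)"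

definition right_face ::
  "('k::field \<Rightarrow> 'v::ab_group_add \<Rightarrow> 'v) \<Rightarrow> (('k, 'v) tensor \<Rightarrow> ('k, 'v) tensor) \<Rightarrow>
    ('v \<Rightarrow> 'k) \<Rightarrow> nat \<Rightarrow> nat \<Rightarrow> ('k, 'v) tensor \<Rightarrow> ('k, 'v) tensor" where
  "right_face scale \<sigma> \<zeta> n i = act_at scale 1 n n (form_map scale \<zeta>) \<circ> T_perm scale \<sigma> n (to_right n i)"

definition degeneracy ::
  "('k::field \<Rightarrow> 'v::ab_group_add \<Rightarrow> 'v) \<Rightarrow> ('v \<Rightarrow> ('k, 'v) tensor) \<Rightarrow>
    nat \<Rightarrow> nat \<Rightarrow> ('k, 'v) tensor \<Rightarrow> ('k, 'v) tensor" where
  "degeneracy scale \<Delta> n i = act_at scale 1 n i (comult_map \<Delta>)"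


section \<open>Simplicial vocabulary\<close>

text \<open>
  The spaces \<open>V n\<close> are subspaces of one ambient space with scalar multiplication \<open>sc\<close>; the maps
  \<open>d n i\<close> and \<open>s n i\<close> have source \<open>V n\<close> and matter only for \<open>1 \<le> i \<le> n\<close>.
\<close>

definition presimplicial ::
  "('k::field \<Rightarrow> 'a::ab_group_add \<Rightarrow> 'a) \<Rightarrow> (nat \<Rightarrow> 'a set) \<Rightarrow> (nat \<Rightarrow> nat \<Rightarrow> 'a \<Rightarrow> 'a) \<Rightarrow> bool" where
  "presimplicial sc V d \<longleftrightarrow>
    vector_space sc \<and> (\<forall>n. module.subspace sc (V n)) \<and>
    (\<forall>n i. 1 \<le> i \<and> i \<le> n \<longrightarrow> linear_between sc (V n) (V (n - 1)) (d n i)) \<and>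
    (\<forall>n i j. \<forall>x\<in>V n. 1 \<le> i \<and> i < j \<and> j \<le> n \<longrightarrow>
      d (n - 1) i (d n j x) = d (n - 1) (j - 1) (d n i x))"

definition very_weakly_simplicial ::
  "('k::field \<Rightarrow> 'a::ab_group_add \<Rightarrow> 'a) \<Rightarrow> (nat \<Rightarrow> 'a set) \<Rightarrow> (nat \<Rightarrow> nat \<Rightarrow> 'a \<Rightarrow> 'a) \<Rightarrow>
    (nat \<Rightarrow> nat \<Rightarrow> 'a \<Rightarrow> 'a) \<Rightarrow> bool" where
  "very_weakly_simplicial sc V d s \<longleftrightarrow>
    presimplicial sc V d \<and>
    (\<forall>n i. 1 \<le> i \<and> i \<le> n \<longrightarrow> linear_between sc (V n) (V (n + 1)) (s n i)) \<and>
    (\<forall>n i j. \<forall>x\<in>V n. 1 \<le> i \<and> i \<le> j \<and> j \<le> n \<longrightarrow>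
      s (n + 1) i (s n j x) = s (n + 1) (j + 1) (s n i x)) \<and>
    (\<forall>n i j. \<forall>x\<in>V n. 1 \<le> i \<and> i < j \<and> j \<le> n \<longrightarrow>
      d (n + 1) i (s n j x) = s (n - 1) (j - 1) (d n i x)) \<and>
    (\<forall>n i j. \<forall>x\<in>V n. 1 \<le> j \<and> j + 1 < i \<and> i \<le> n + 1 \<longrightarrow>
      d (n + 1) i (s n j x) = s (n - 1) j (d n (i - 1) x))"

definition weakly_simplicial ::
  "('k::field \<Rightarrow> 'a::ab_group_add \<Rightarrow> 'a) \<Rightarrow> (nat \<Rightarrow> 'a set) \<Rightarrow> (nat \<Rightarrow> nat \<Rightarrow> 'a \<Rightarrow> 'a) \<Rightarrow>
    (nat \<Rightarrow> nat \<Rightarrow> 'a \<Rightarrow> 'a) \<Rightarrow> bool" where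
  "weakly_simplicial sc V d s \<longleftrightarrow>
    very_weakly_simplicial sc V d s \<and>
    (\<forall>n i. \<forall>x\<in>V n. 1 \<le> i \<and> i \<le> n \<longrightarrow> d (n + 1) i (s n i x) = d (n + 1) (i + 1) (s n i x))"

definition pre_bisimplicial ::
  "('k::field \<Rightarrow> 'a::ab_group_add \<Rightarrow> 'a) \<Rightarrow> (nat \<Rightarrow> 'a set) \<Rightarrow> (nat \<Rightarrow> nat \<Rightarrow> 'a \<Rightarrow> 'a) \<Rightarrow>
    (nat \<Rightarrow> nat \<Rightarrow> 'a \<Rightarrow> 'a) \<Rightarrow> bool" where
  "pre_bisimplicial sc V d d' \<longleftrightarrow>
    presimplicial sc V d \<and> presimplicial sc V d' \<and>
    (\<forall>n i j. \<forall>x\<in>V n. 1 \<le> i \<and> i < j \<and> j \<le> n \<longrightarrow>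
      d (n - 1) i (d' n j x) = d' (n - 1) (j - 1) (d n i x) \<and>
      d' (n - 1) i (d n j x) = d (n - 1) (j - 1) (d' n i x))"

definition very_weakly_bisimplicial ::
  "('k::field \<Rightarrow> 'a::ab_group_add \<Rightarrow> 'a) \<Rightarrow> (nat \<Rightarrow> 'a set) \<Rightarrow> (nat \<Rightarrow> nat \<Rightarrow> 'a \<Rightarrow> 'a) \<Rightarrow>
    (nat \<Rightarrow> nat \<Rightarrow> 'a \<Rightarrow> 'a) \<Rightarrow> (nat \<Rightarrow> nat \<Rightarrow> 'a \<Rightarrow> 'a) \<Rightarrow> bool" where
  "very_weakly_bisimplicial sc V d d' s \<longleftrightarrow>
    pre_bisimplicial sc V d d' \<and>
    very_weakly_simplicial sc V d s \<and> very_weakly_simplicial sc V d' s"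

definition weakly_bisimplicial ::
  "('k::field \<Rightarrow> 'a::ab_group_add \<Rightarrow> 'a) \<Rightarrow> (nat \<Rightarrow> 'a set) \<Rightarrow> (nat \<Rightarrow> nat \<Rightarrow> 'a \<Rightarrow> 'a) \<Rightarrow>
    (nat \<Rightarrow> nat \<Rightarrow> 'a \<Rightarrow> 'a) \<Rightarrow> (nat \<Rightarrow> nat \<Rightarrow> 'a \<Rightarrow> 'a) \<Rightarrow> bool" where
  "weakly_bisimplicial sc V d d' s \<longleftrightarrow>
    pre_bisimplicial sc V d d' \<and>
    weakly_simplicial sc V d s \<and> weakly_simplicial sc V d' s"

end

theory Submission
  imports Defs
begin

text \<open>
  Read a composite of the maps involved as a diagram of strands.  The face \<open>d\<^sub>i\<close> pulls the
  \<open>i\<close>-th strand to the left end, crossing the strands \<open>i - 1, \<dots>, 1\<close> in turn, and kills it there by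
  \<open>\<epsilon>\<close>; the face \<open>d'\<^sub>i\<close> pulls it to the right end and kills it by \<open>\<zeta>\<close>.  Both families therefore
  satisfy one-step recursions in the operators \<open>\<sigma>\<^sub>i\<close>,
  \<open>d\<^sub>1 = \<epsilon>\<^sub>1\<close>, \<open>d\<^sub>i\<^sub>+\<^sub>1 = d\<^sub>i \<circ> \<sigma>\<^sub>i\<close> and \<open>d'\<^sub>n = \<zeta>\<^sub>n\<close>, \<open>d'\<^sub>i = d'\<^sub>i\<^sub>+\<^sub>1 \<circ> \<sigma>\<^sub>i\<close>,
  and every identity is proved by induction on an index from these recursions
  (\<open>L_Suc\<close>, \<open>R_Suc\<close>).

  Three facts carry the inductions.  Operators on disjoint groups of factors commute
  (\<open>act_at_commute\<close>), so an operator that the pulled strand does not meet commutes with the face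
  up to a shift of its position (\<open>L_natural\<close>, \<open>R_natural\<close>).  An operator that the strand does
  meet also commutes with the face as soon as it can be slid through one crossing (\<open>L_past\<close>,
  \<open>R_past\<close>): for \<open>\<sigma>\<close> this is the Yang--Baxter equation, for \<open>\<Delta>\<close> one of the two compatibility
  conditions of a pre-braided coalgebra, the first for pulling to the left and the second for
  pulling to the right.  Finally, two strands killed next to each other may be crossed beforehand,
  which is the condition on characters or compatible pairs (\<open>apply_forms_S\<close>).

  Thus \<open>d\<^sub>id\<^sub>j = d\<^sub>j\<^sub>-\<^sub>1d\<^sub>i\<close> for \<open>i < j\<close> compares two diagrams that, up to Yang--Baxter moves, differ
  by the crossing of the two killed strands (\<open>L_L\<close>, \<open>R_R\<close>); a left face and a right face kill
  their strands at opposite ends, and here both orders give the same diagram up to such moves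
  (\<open>L_R\<close>, \<open>R_L\<close>).  In the cocommutative case \<open>d\<^sub>is\<^sub>i\<close> and
  \<open>d\<^sub>i\<^sub>+\<^sub>1s\<^sub>i\<close> differ by the crossing \<open>\<sigma>\<^sub>i\<Delta>\<^sub>i = \<Delta>\<^sub>i\<close>, and likewise for \<open>d'\<close>.

  To have these recursions, one needs that the only shortest words of the cycles \<open>p\<^sub>i\<^sub>,\<^sub>n\<close> and
  \<open>p'\<^sub>i\<^sub>,\<^sub>n\<close> are the evident ones: a letter moves a point by at most one place, so a word of
  minimal length must move \<open>i\<close> towards its target at every letter.  The formulas for the differentials then say that the shuffles in \<open>Sh\<^sub>1\<^sub>,\<^sub>n\<^sub>-\<^sub>1\<close> and
  \<open>Sh\<^sub>n\<^sub>-\<^sub>1\<^sub>,\<^sub>1\<close> are the inverses of these cycles, and that replacing \<open>\<sigma>\<close> by \<open>-\<sigma>\<close> contributes one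
  sign for each crossing.
\<close>


section \<open>Linear maps between tensor powers\<close>

interpretation T: vector_space "tscale :: 'k::field \<Rightarrow> ('k, 'v) tensor \<Rightarrow> ('k, 'v) tensor"
  by (rule vector_space_tscale)

locale tensor_powers =
  fixes scale :: "'k::field \<Rightarrow> 'v::ab_group_add \<Rightarrow> 'v"
  assumes V: "vector_space scale"
begin

abbreviation P :: "'v list \<Rightarrow> ('k, 'v) tensor" where
  "P \<equiv> pure_tensor scale"

abbreviation W :: "nat \<Rightarrow> ('k, 'v) tensor set" where
  "W \<equiv> tpow scale"

abbreviation tprod_infix :: "('k, 'v) tensor \<Rightarrow> ('k, 'v) tensor \<Rightarrow> ('k, 'v) tensor"
  (infixr "\<otimes>" 75) where
  "s \<otimes> t \<equiv> tprod scale s t"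

abbreviation lin :: "nat \<Rightarrow> nat \<Rightarrow> (('k, 'v) tensor \<Rightarrow> ('k, 'v) tensor) \<Rightarrow> bool" where
  "lin m n \<equiv> linear_between tscale (W m) (W n)"

lemma subspace_tpow: "T.subspace (W n)"
  unfolding tpow_def by simp

lemma lin_in: "lin m n f \<Longrightarrow> t \<in> W m \<Longrightarrow> f t \<in> W n"
  by (auto simp: linear_between_def)

lemma lin_scaleD: "lin m n f \<Longrightarrow> t \<in> W m \<Longrightarrow> f (tscale c t) = tscale c (f t)"
  by (simp add: linear_between_def)

lemma lin_comp: "lin m n f \<Longrightarrow> lin n r g \<Longrightarrow> lin m r (\<lambda>t. g (f t))"
  by (simp add: linear_between_def image_subset_iff)

lemma lin_tscale: "lin m n f \<Longrightarrow> lin m n (\<lambda>t. tscale c (f t))"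
  unfolding linear_between_def
  by (auto simp: T.scale_right_distrib T.scale_left_commute image_subset_iff
      intro!: T.subspace_scale[OF subspace_tpow])

lemma tpow_induct [consumes 1, case_names pure add scale]:
  assumes "t \<in> W n"
    and "\<And>xs. length xs = n \<Longrightarrow> Q (P xs)"
    and "\<And>x y. x \<in> W n \<Longrightarrow> y \<in> W n \<Longrightarrow> Q x \<Longrightarrow> Q y \<Longrightarrow> Q (x + y)"
    and "\<And>c x. x \<in> W n \<Longrightarrow> Q x \<Longrightarrow> Q (tscale c x)"
  shows "Q t"
proof -
  let ?S = "{x \<in> W n. Q x}"
  \<comment> \<open>Zero is not a separate case, being a multiple of a pure tensor.\<close>
  have p: "P (replicate n 0) \<in> W n" "Q (P (replicate n 0))"
    by (simp_all add: pure_in_tpow assms(2))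
  have "0 \<in> ?S"
    using T.subspace_0[OF subspace_tpow[of n]] assms(4)[OF p, of 0] by simp
  then have "T.subspace ?S"
    unfolding T.subspace_def
    by (auto intro: assms(3,4) T.subspace_add[OF subspace_tpow] T.subspace_scale[OF subspace_tpow])
  then have "T.span (P ` {xs. length xs = n}) \<subseteq> ?S"
    using assms(2) pure_in_tpow by (intro T.span_minimal) auto
  then show ?thesis
    using assms(1) unfolding tpow_def by auto
qed

lemma lin_eqI:
  assumes "lin m n f" "lin m n' g" "\<And>xs. length xs = m \<Longrightarrow> f (P xs) = g (P xs)" "t \<in> W m"
  shows "f t = g t"
  using assms(4,3,1,2)
  by (induction rule: tpow_induct) (auto simp: linear_between_def)

lemma lin_if_linear:
  assumes h: "Vector_Spaces.linear tscale tscale h"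
    and pure: "\<And>xs. length xs = m \<Longrightarrow> h (P xs) \<in> W n"
  shows "lin m n h"
proof -
  have add: "h (x + y) = h x + h y" and scale: "h (tscale c x) = tscale c (h x)" for x y c
    using h by (simp_all only: Vector_Spaces.linear_iff)
  have "h t \<in> W n" if "t \<in> W m" for t
    using that
    by (induction rule: tpow_induct)
      (simp_all only: pure add scale T.subspace_add[OF subspace_tpow]
        T.subspace_scale[OF subspace_tpow])
  then show ?thesis
    by (simp only: linear_between_def image_subset_iff add scale) simp
qed

text \<open>
  Evaluating \<open>u\<close> in the last arguments of a multilinear family must leave a multilinear family,
  since a product vanishes on all others.  This holds for \<open>u\<close> in a tensor power, and it concerns
  only the last factor.
\<close>

lemma tprod_assoc:
  assumes "u \<in> W k"
  shows "(s \<otimes> t) \<otimes> u = s \<otimes> t \<otimes> u"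
proof
  fix f
  show "((s \<otimes> t) \<otimes> u) f = (s \<otimes> t \<otimes> u) f"
  proof (cases "multilinear scale f")
    case True
    show ?thesis
      by (simp add: tprod_def True multilinear_tpow[OF V assms True] multilinear_append(1)[OF True])
  qed (simp add: tprod_def)
qed

lemma tprod_unit_left:
  assumes "t \<in> W k"
  shows "P [] \<otimes> t = t"
proof -
  have "t f = 0" if "\<not> multilinear scale f" for f
    using tpow_eval[OF assms] that by metis
  moreover have "multilinear scale (\<lambda>us. t (\<lambda>ws. f (us @ ws)))" if "multilinear scale f" for f
    by (rule multilinear_tpow[OF V assms that])
  ultimately show ?thesis
    by (simp add: tprod_def pure_tensor_def fun_eq_iff)
qed

lemma tprod_unit_right:
  assumes "t \<in> W k"
  shows "t \<otimes> P [] = t"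
proof -
  have "t f = 0" if "\<not> multilinear scale f" for f
    using tpow_eval[OF assms] that by metis
  then show ?thesis
    by (simp add: tprod_def pure_tensor_def fun_eq_iff multilinear_append(1))
qed

lemma lin_tprod_left: "u \<in> W p \<Longrightarrow> lin q (p + q) (\<lambda>y. u \<otimes> y)"
  by (simp add: linear_between_def image_subset_iff tprod_in_tpow[OF V]
      tprod_linear_right[OF V, of u p _ q])

lemma lin_tprod_right: "y \<in> W q \<Longrightarrow> lin p (p + q) (\<lambda>u. u \<otimes> y)"
  by (simp add: linear_between_def image_subset_iff tprod_in_tpow[OF V]
      tprod_add_left tprod_scale_left)

text \<open>
  Instead of pure tensors, maps can be compared on products of two blocks of factors.  This is the
  form that suits operators acting on one of the blocks.
\<close>

lemma lin_eqI2:
  assumes "lin (p + q) n f" "lin (p + q) n' g"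
    and "\<And>u y. u \<in> W p \<Longrightarrow> y \<in> W q \<Longrightarrow> f (u \<otimes> y) = g (u \<otimes> y)" "t \<in> W (p + q)"
  shows "f t = g t"
proof (rule lin_eqI[OF assms(1,2) _ assms(4)])
  fix xs :: "'v list" assume xs: "length xs = p + q"
  have "f (P (take p xs) \<otimes> P (drop p xs)) = g (P (take p xs) \<otimes> P (drop p xs))"
    by (intro assms(3) pure_in_tpow) (use xs in auto)
  then show "f (P xs) = g (P xs)"
    by (simp add: tprod_pure)
qed


section \<open>Operators acting on consecutive tensor factors\<close>

lemma split_list_at:
  assumes "1 \<le> i" "i + l \<le> length xs + 1"
  obtains us vs ws where "xs = us @ vs @ ws" "length us + 1 = i" "length vs = l"
    "length us + l + length ws = length xs"
proof
  show "xs = take (i - 1) xs @ take l (drop (i - 1) xs) @ drop (i - 1 + l) xs"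
    by (metis append_take_drop_id drop_drop add.commute)
qed (use assms in auto)

lemma lin_act:
  assumes \<phi>: "lin l r \<phi>" and "1 \<le> i" "i + l \<le> n + 1" "n + r = m + l"
  shows "lin n m (act_at scale l n i \<phi>)"
proof (rule lin_if_linear)
  show "Vector_Spaces.linear tscale tscale (act_at scale l n i \<phi>)"
    unfolding act_at_def by (rule linear_tlift)
  fix xs :: "'v list" assume n: "length xs = n"
  have "i + l \<le> length xs + 1" using n assms by simp
  with assms(2) obtain us vs ws where xs: "xs = us @ vs @ ws"
    and len: "length us + 1 = i" "length vs = l" "length us + l + length ws = length xs"
    by (rule split_list_at)
  have "P us \<otimes> \<phi> (P vs) \<otimes> P ws \<in> W (length us + (r + length ws))"
    using len by (intro tprod_in_tpow[OF V] pure_in_tpow lin_in[OF \<phi>]) simp_all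
  moreover have "length us + (r + length ws) = m"
    using assms len n by simp
  moreover have "act_at scale l n i \<phi> (P xs) = P us \<otimes> \<phi> (P vs) \<otimes> P ws"
    unfolding xs using len n by (intro act_at_pure[OF V \<phi>]) simp_all
  ultimately show "act_at scale l n i \<phi> (P xs) \<in> W m"
    by simp
qed

text \<open>
  An operator placed inside one of two blocks ignores the other block.  With this and its mirror
  image, diagrams can be cut into blocks wherever convenient.
  On pure tensors the statement is the associativity of the tensor product.
\<close>

lemma act_at_tprod_right:
  assumes \<phi>: "lin l r \<phi>" and "1 \<le> j" "j + l \<le> q + 1"
    and u: "u \<in> W p" and y: "y \<in> W q" and n: "n = p + q" "i = p + j"
  shows "act_at scale l n i \<phi> (u \<otimes> y) = u \<otimes> act_at scale l q j \<phi> y"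
proof -
  let ?q = "q - l + r"
  have q: "q + r = ?q + l" using assms(2,3) by simp
  have "lin (p + q) (p + ?q) (act_at scale l n i \<phi>)"
    unfolding n by (rule lin_act[OF \<phi>]) (use assms(2,3) in simp_all)
  note act_n = this and act_q = lin_act[OF \<phi> assms(2,3) q]
  have pure: "act_at scale l n i \<phi> (P us \<otimes> P ys) = P us \<otimes> act_at scale l q j \<phi> (P ys)"
    if us: "length us = p" and ys: "length ys = q" for us ys
  proof -
    have "j + l \<le> length ys + 1" using ys assms by simp
    with assms(2) obtain as vs ws where ys': "ys = as @ vs @ ws"
      and len: "length as + 1 = j" "length vs = l" "length as + l + length ws = length ys"
      by (rule split_list_at)
    have "\<phi> (P vs) \<otimes> P ws \<in> W (r + length ws)"
      using len by (intro tprod_in_tpow[OF V] pure_in_tpow lin_in[OF \<phi>]) simp_all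
    note assoc = tprod_assoc[OF this, of "P us" "P as"]
    have "act_at scale l n i \<phi> (P us \<otimes> P ys) = act_at scale l n i \<phi> (P ((us @ as) @ vs @ ws))"
      by (simp add: ys' tprod_pure)
    also have "\<dots> = P (us @ as) \<otimes> \<phi> (P vs) \<otimes> P ws"
      using len us ys assms(6,7) by (intro act_at_pure[OF V \<phi>]) simp_all
    also have "\<dots> = P us \<otimes> P as \<otimes> \<phi> (P vs) \<otimes> P ws"
      using assoc by (simp add: tprod_pure)
    also have "P as \<otimes> \<phi> (P vs) \<otimes> P ws = act_at scale l q j \<phi> (P ys)"
      unfolding ys' using len ys by (intro act_at_pure[OF V \<phi>, symmetric]) simp_all
    finally show ?thesis .
  qed
  have "act_at scale l n i \<phi> (P us \<otimes> y) = P us \<otimes> act_at scale l q j \<phi> y"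
    if us: "length us = p" for us
    by (rule lin_eqI[OF lin_comp[OF lin_tprod_left act_n] lin_comp[OF act_q lin_tprod_left] _ y])
       (use us pure pure_in_tpow in simp_all)
  then show ?thesis
    by (intro lin_eqI[OF lin_comp[OF lin_tprod_right act_n] lin_tprod_right _ u])
       (use y lin_in[OF act_q] in simp_all)
qed

lemma act_at_tprod_left:
  assumes \<phi>: "lin l r \<phi>" and "1 \<le> i" "i + l \<le> p + 1"
    and u: "u \<in> W p" and y: "y \<in> W q" and n: "n = p + q"
  shows "act_at scale l n i \<phi> (u \<otimes> y) = act_at scale l p i \<phi> u \<otimes> y"
proof -
  let ?p = "p - l + r"
  have p: "p + r = ?p + l" using assms(2,3) by simp
  have "lin (p + q) (?p + q) (act_at scale l n i \<phi>)"
    unfolding n by (rule lin_act[OF \<phi>]) (use assms(2,3) in simp_all)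
  note act_n = this and act_p = lin_act[OF \<phi> assms(2,3) p]
  have pure: "act_at scale l n i \<phi> (P us \<otimes> P ys) = act_at scale l p i \<phi> (P us) \<otimes> P ys"
    if us: "length us = p" and ys: "length ys = q" for us ys
  proof -
    have "i + l \<le> length us + 1" using us assms by simp
    with assms(2) obtain as vs ws where us': "us = as @ vs @ ws"
      and len: "length as + 1 = i" "length vs = l" "length as + l + length ws = length us"
      by (rule split_list_at)
    have "act_at scale l n i \<phi> (P us \<otimes> P ys) = act_at scale l n i \<phi> (P (as @ vs @ (ws @ ys)))"
      by (simp add: us' tprod_pure)
    also have "\<dots> = P as \<otimes> \<phi> (P vs) \<otimes> P (ws @ ys)"
      using len us ys assms(6) by (intro act_at_pure[OF V \<phi>]) simp_all
    also have "\<dots> = (P as \<otimes> \<phi> (P vs) \<otimes> P ws) \<otimes> P ys"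
      by (simp only: tprod_assoc[OF pure_in_tpow[OF ys]] tprod_pure)
    also have "P as \<otimes> \<phi> (P vs) \<otimes> P ws = act_at scale l p i \<phi> (P us)"
      unfolding us' using len us by (intro act_at_pure[OF V \<phi>, symmetric]) simp_all
    finally show ?thesis .
  qed
  have "act_at scale l n i \<phi> (P us \<otimes> y) = act_at scale l p i \<phi> (P us) \<otimes> y"
    if us: "length us = p" for us
    by (rule lin_eqI[OF lin_comp[OF lin_tprod_left act_n]
            lin_tprod_left[OF lin_in[OF act_p pure_in_tpow[OF us]]] _ y])
       (use us pure pure_in_tpow in simp_all)
  then show ?thesis
    by (intro lin_eqI[OF lin_comp[OF lin_tprod_right act_n] lin_comp[OF act_p lin_tprod_right] _ u])
       (use y in simp_all)
qed

lemma act_at_full: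
  assumes \<phi>: "lin l r \<phi>" and t: "t \<in> W l"
  shows "act_at scale l l 1 \<phi> t = \<phi> t"
proof (rule lin_eqI[OF _ \<phi> _ t])
  show "lin l r (act_at scale l l 1 \<phi>)"
    using \<phi> by (rule lin_act) auto
  fix xs :: "'v list" assume xs: "length xs = l"
  have "act_at scale l l 1 \<phi> (P ([] @ xs @ [])) = P [] \<otimes> \<phi> (P xs) \<otimes> P []"
    by (rule act_at_pure[OF V \<phi>]) (use xs in auto)
  also have "\<dots> = \<phi> (P xs)"
    using lin_in[OF \<phi> pure_in_tpow[OF xs]] by (simp add: tprod_unit_left tprod_unit_right)
  finally show "act_at scale l l 1 \<phi> (P xs) = \<phi> (P xs)" by simp
qed

text \<open>
  Cutting the tensor power just before the second operator puts the two operators into different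
  blocks.  The numbers \<open>n'\<close>, \<open>m\<close>, \<open>j'\<close> are the tensor degrees and the position after one of
  the operators has changed the number of factors; they are given by additive equations so that
  no truncated subtraction occurs.
\<close>

lemma act_at_commute:
  assumes \<phi>: "lin l r \<phi>" and \<psi>: "lin l' r' \<psi>"
    and ij: "1 \<le> i" "i + l \<le> j" "j + l' \<le> n + 1"
    and n: "n' + l' = n + r'" "m + l = n + r" "j' + l = j + r" and t: "t \<in> W n"
  shows "act_at scale l n' i \<phi> (act_at scale l' n j \<psi> t) =
    act_at scale l' m j' \<psi> (act_at scale l n i \<phi> t)"
proof -
  define p q where "p = j - 1" and "q = n - p"
  define p' q' where "p' = p - l + r" and "q' = q - l' + r'"
  have pq: "n = p + q" "j = p + 1" "1 + l' \<le> q + 1" "i + l \<le> p + 1"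
    "n' = p + q'" "m = p' + q" "j' = p' + 1" "p + r = p' + l" "q + r' = q' + l'"
    using ij n by (auto simp: p_def q_def p'_def q'_def)
  have l\<phi>: "lin p p' (act_at scale l p i \<phi>)" and l\<psi>: "lin q q' (act_at scale l' q 1 \<psi>)"
    using pq ij by (simp_all add: lin_act[OF \<phi>] lin_act[OF \<psi>])
  have lin1: "lin (p + q) n' (act_at scale l' n j \<psi>)" "lin n' (p' + q') (act_at scale l n' i \<phi>)"
    and lin2: "lin (p + q) m (act_at scale l n i \<phi>)" "lin m (p' + q') (act_at scale l' m j' \<psi>)"
    using pq ij by (simp_all add: lin_act[OF \<phi>] lin_act[OF \<psi>])
  show ?thesis
  proof (rule lin_eqI2[OF lin_comp[OF lin1] lin_comp[OF lin2]])
    show "t \<in> W (p + q)" using t pq by simp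
    fix u y assume u: "u \<in> W p" and y: "y \<in> W q"
    have "act_at scale l n' i \<phi> (act_at scale l' n j \<psi> (u \<otimes> y)) =
        act_at scale l p i \<phi> u \<otimes> act_at scale l' q 1 \<psi> y"
      using act_at_tprod_right[OF \<psi> _ pq(3) u y pq(1,2)]
        act_at_tprod_left[OF \<phi> ij(1) pq(4) u lin_in[OF l\<psi> y] pq(5)] by simp
    also have "\<dots> = act_at scale l' m j' \<psi> (act_at scale l n i \<phi> (u \<otimes> y))"
      using act_at_tprod_left[OF \<phi> ij(1) pq(4) u y pq(1)]
        act_at_tprod_right[OF \<psi> _ pq(3) lin_in[OF l\<phi> u] y pq(6,7)] by simp
    finally show "act_at scale l n' i \<phi> (act_at scale l' n j \<psi> (u \<otimes> y)) =
        act_at scale l' m j' \<psi> (act_at scale l n i \<phi> (u \<otimes> y))" .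
  qed
qed

text \<open>
  Together with \<open>act_at_inside\<close>, this transports an identity between operators on a block of
  \<open>m\<close> neighbouring factors to all positions of that block in a tensor power.
\<close>

lemma lin_eqI3:
  assumes N: "N = p + (m + q)" and f: "lin N n f" and g: "lin N n' g"
    and eq: "\<And>u x w. u \<in> W p \<Longrightarrow> x \<in> W m \<Longrightarrow> w \<in> W q \<Longrightarrow> f (u \<otimes> x \<otimes> w) = g (u \<otimes> x \<otimes> w)"
    and t: "t \<in> W N"
  shows "f t = g t"
proof (rule lin_eqI2[OF f[unfolded N] g[unfolded N] _ t[unfolded N]])
  fix u y assume u: "u \<in> W p" and y: "y \<in> W (m + q)"
  show "f (u \<otimes> y) = g (u \<otimes> y)"
    by (rule lin_eqI2[OF lin_comp[OF lin_tprod_left[OF u] f[unfolded N]]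
            lin_comp[OF lin_tprod_left[OF u] g[unfolded N]] _ y])
      (rule eq[OF u])
qed

lemma act_at_inside:
  assumes \<phi>: "lin l r \<phi>" and j: "1 \<le> j" "j + l \<le> m + 1"
    and u: "u \<in> W p" and x: "x \<in> W m" and w: "w \<in> W q" and n: "n = p + (m + q)" "i = p + j"
  shows "act_at scale l n i \<phi> (u \<otimes> x \<otimes> w) = u \<otimes> act_at scale l m j \<phi> x \<otimes> w"
proof -
  have "x \<otimes> w \<in> W (m + q)"
    by (rule tprod_in_tpow[OF V x w])
  then have "act_at scale l n i \<phi> (u \<otimes> x \<otimes> w) = u \<otimes> act_at scale l (m + q) j \<phi> (x \<otimes> w)"
    using j n by (intro act_at_tprod_right[OF \<phi> _ _ u]) simp_all
  also have "act_at scale l (m + q) j \<phi> (x \<otimes> w) = act_at scale l m j \<phi> x \<otimes> w"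
    by (rule act_at_tprod_left[OF \<phi> j x w refl])
  finally show ?thesis .
qed

lemma act_at_inside_full:
  assumes \<phi>: "lin l r \<phi>"
    and "u \<in> W p" "x \<in> W l" "w \<in> W q" and "n = p + (l + q)" "i = p + 1"
  shows "act_at scale l n i \<phi> (u \<otimes> x \<otimes> w) = u \<otimes> \<phi> x \<otimes> w"
  using act_at_inside[OF \<phi> _ _ assms(2-)] act_at_full[OF \<phi> assms(3)] by simp


section \<open>Forms and comultiplications on the first tensor power\<close>

lemma form_map_pure:
  assumes "Vector_Spaces.linear scale (*) \<epsilon>"
  shows "form_map scale \<epsilon> (P [v]) = tscale (\<epsilon> v) (P [])"
proof -
  have "Vector_Spaces.linear scale tscale (\<lambda>v. tscale (\<epsilon> (hd (us @ v # ws))) (P []))"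
    if "length us + 1 + length ws = 1" for us ws :: "'v list"
    using assms that vector_space_tscale
    by (simp add: Vector_Spaces.linear_iff T.scale_left_distrib)
  then show ?thesis
    unfolding form_map_def by (subst tlift_pure[OF V]) simp_all
qed

lemma lin_form_map:
  assumes "Vector_Spaces.linear scale (*) \<epsilon>"
  shows "lin 1 0 (form_map scale \<epsilon>)"
proof (rule lin_if_linear)
  show "Vector_Spaces.linear tscale tscale (form_map scale \<epsilon>)"
    unfolding form_map_def by (rule linear_tlift)
  fix xs :: "'v list" assume "length xs = 1"
  then obtain v where "xs = [v]" by (auto simp: length_Suc_conv)
  then show "form_map scale \<epsilon> (P xs) \<in> W 0"
    using T.subspace_scale[OF subspace_tpow pure_in_tpow] by (simp add: form_map_pure[OF assms])
qed

lemma comult_map_pure: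
  assumes "Vector_Spaces.linear scale tscale \<Delta>"
  shows "comult_map \<Delta> (P [v]) = \<Delta> v"
proof -
  have "Vector_Spaces.linear scale tscale (\<lambda>v. \<Delta> (hd (us @ v # ws)))"
    if "length us + 1 + length ws = 1" for us ws :: "'v list"
    using assms that by simp
  then show ?thesis
    unfolding comult_map_def by (subst tlift_pure[OF V]) simp_all
qed

lemma lin_comult_map:
  assumes "Vector_Spaces.linear scale tscale \<Delta>" "range \<Delta> \<subseteq> W 2"
  shows "lin 1 2 (comult_map \<Delta>)"
proof (rule lin_if_linear)
  show "Vector_Spaces.linear tscale tscale (comult_map \<Delta>)"
    unfolding comult_map_def by (rule linear_tlift)
  fix xs :: "'v list" assume "length xs = 1"
  then obtain v where "xs = [v]" by (auto simp: length_Suc_conv)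
  then show "comult_map \<Delta> (P xs) \<in> W 2"
    using assms(2) by (auto simp: comult_map_pure[OF assms(1)])
qed

lemma form_prod_pure:
  assumes "Vector_Spaces.linear scale (*) f" "Vector_Spaces.linear scale (*) g"
  shows "form_prod f g (P [a, b]) = f a * g b"
proof -
  let ?h = "\<lambda>xs. if length xs = 2 then f (xs ! 0) * g (xs ! 1) else 0"
  have "multilinear scale ?h"
    unfolding multilinear_def
  proof (intro allI)
    fix us ws :: "'v list"
    consider "length us + 1 + length ws \<noteq> 2" | u where "us = [u]" "ws = []"
      | w where "us = []" "ws = [w]"
      by (cases us; cases ws) auto
    then show "Vector_Spaces.linear scale (*) (\<lambda>v. ?h (us @ v # ws))"
      using assms V vector_space_times
      by cases (simp_all add: Vector_Spaces.linear_iff algebra_simps)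
  qed
  then show ?thesis
    by (simp add: form_prod_def pure_tensor_def)
qed

text \<open>
  Killing two neighbouring strands from the left evaluates the product form.  Conditions on
  \<open>form_prod\<close>, as in the notions of character and of compatible forms, thereby become
  identities between operators.
\<close>

lemma form_map_twice:
  assumes f: "Vector_Spaces.linear scale (*) f" and g: "Vector_Spaces.linear scale (*) g"
    and x: "x \<in> W 2"
  shows "form_map scale g (act_at scale 1 2 1 (form_map scale f) x) = tscale (form_prod f g x) (P [])"
proof (rule lin_eqI[OF _ _ _ x])
  have "lin 2 1 (act_at scale 1 2 1 (form_map scale f))"
    by (rule lin_act[OF lin_form_map[OF f]]) simp_all
  from lin_comp[OF this lin_form_map[OF g]]
  show "lin 2 0 (\<lambda>x. form_map scale g (act_at scale 1 2 1 (form_map scale f) x))" .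
  show "lin 2 0 (\<lambda>x. tscale (form_prod f g x) (P []))"
  proof (rule lin_if_linear)
    show "Vector_Spaces.linear tscale tscale (\<lambda>x. tscale (form_prod f g x) (P []))"
      using vector_space_tscale
      by (simp add: Vector_Spaces.linear_iff form_prod_def tscale_def fun_eq_iff algebra_simps)
    show "tscale (form_prod f g (P xs)) (P []) \<in> W 0" for xs
      by (rule T.subspace_scale[OF subspace_tpow pure_in_tpow]) simp
  qed
  fix xs :: "'v list" assume "length xs = 2"
  then obtain a b where xs: "xs = [a, b]"
    by (auto simp: length_Suc_conv numeral_2_eq_2)
  have b: "P [b] \<in> W 1" by (rule pure_in_tpow) simp
  have "act_at scale 1 2 1 (form_map scale f) (P ([] @ [a] @ [b])) =
      P [] \<otimes> form_map scale f (P [a]) \<otimes> P [b]"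
    by (rule act_at_pure[OF V lin_form_map[OF f]]) simp_all
  also have "\<dots> = tscale (f a) (P [b])"
    using tprod_unit_left[OF T.subspace_scale[OF subspace_tpow b]]
    by (simp add: form_map_pure[OF f] tprod_scale_left tprod_pure)
  finally show "form_map scale g (act_at scale 1 2 1 (form_map scale f) (P xs)) =
      tscale (form_prod f g (P xs)) (P [])"
    using lin_form_map[OF g] b
    by (simp add: xs linear_between_def form_map_pure[OF g] form_prod_pure[OF f g])
qed

end


section \<open>Shortest words of the two cycles\<close>

lemma word_perm_Nil: "word_perm [] = id"
  by (simp add: word_perm_def)

lemma word_perm_Cons: "word_perm (a # w) = transpose a (a + 1) \<circ> word_perm w"
  by (simp add: word_perm_def)

lemma word_perm_snoc: "word_perm (w @ [a]) = word_perm w \<circ> transpose a (a + 1)"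
  by (induction w) (simp_all add: word_perm_Nil word_perm_Cons comp_assoc)

lemma word_perm_bounds: "i \<le> word_perm w i + length w" "word_perm w i \<le> i + length w"
  by (induction w) (auto simp: word_perm_Nil word_perm_Cons transpose_def)

text \<open>
  A letter moves a point by at most one place, so a word no longer than the distance that it
  covers has to move the point down with each letter, and this determines all its letters.
\<close>

lemma word_going_down:
  assumes "word_perm w i = k" "k + length w \<le> i"
  shows "w = [k..<i]"
  using assms
proof (induction w arbitrary: k)
  case (Cons a w)
  have "i \<le> word_perm w i + length w" by (rule word_perm_bounds)
  then have "word_perm w i = a + 1" "k = a"
    using Cons.prems by (auto simp: word_perm_Cons transpose_def split: if_splits)
  then show ?case
    using Cons.IH[of "a + 1"] Cons.prems by (simp add: upt_conv_Cons)
qed (simp add: word_perm_Nil)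

lemma word_going_up:
  assumes "word_perm w i = k" "i + length w \<le> k"
  shows "w = rev [i..<k]"
  using assms
proof (induction w arbitrary: k)
  case (Cons a w)
  have "word_perm w i \<le> i + length w" by (rule word_perm_bounds)
  then have "word_perm w i = a" "k = a + 1"
    using Cons.prems by (auto simp: word_perm_Cons transpose_def split: if_splits)
  then show ?case
    using Cons.IH[of a] Cons.prems by simp
qed (simp add: word_perm_Nil)

text \<open>
  Both permutations enumerate the complement of the common value at \<open>a\<close> in increasing order.
\<close>

lemma permutes_eqI_strict_mono_on:
  fixes f g :: "nat \<Rightarrow> nat"
  assumes f: "f permutes insert a B" "strict_mono_on B f"
    and g: "g permutes insert a B" "strict_mono_on B g"
    and a: "a \<notin> B" "f a = g a"
  shows "f = g"
proof
  fix j
  have *: "p j \<le> q j"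
    if p: "p permutes insert a B" "strict_mono_on B p" and q: "q permutes insert a B"
      and "p a = q a" "j \<in> B" and less: "\<And>k. k < j \<Longrightarrow> k \<in> B \<Longrightarrow> p k = q k" for p q :: "nat \<Rightarrow> nat" and j
  proof -
    have "q j \<in> insert a B"
      using that permutes_in_image[OF q, of j] by simp
    then obtain k where k: "k \<in> insert a B" "p k = q j"
      using permutes_image[OF p(1)] by (metis imageE)
    have "k \<noteq> a" using k that a(1) permutes_inj[OF q] by (metis injD)
    then have "k \<in> B" using k by simp
    have "\<not> k < j"
      using less[of k] \<open>k \<in> B\<close> k permutes_inj[OF q] by (metis injD less_irrefl)
    then have "j \<le> k" by simp
    then have "p j \<le> p k"
      using strict_mono_onD[OF p(2) \<open>j \<in> B\<close> \<open>k \<in> B\<close>] by (cases "j = k") auto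
    then show ?thesis using k by simp
  qed
  have "f j = g j" if "j \<in> B" for j
    using that
  proof (induction j rule: less_induct)
    case (less j)
    have "f j \<le> g j" by (rule *) (use f g a less in auto)
    moreover have "g j \<le> f j" by (rule *) (use f g a less in auto)
    ultimately show ?case by simp
  qed
  then show "f j = g j"
    using a(2) f(1) g(1) by (cases "j \<in> insert a B") (auto simp: permutes_def)
qed

lemma to_left_1: "to_left 1 = id"
  by (auto simp: to_left_def fun_eq_iff)

lemma to_left_Suc: "1 \<le> i \<Longrightarrow> to_left (i + 1) = to_left i \<circ> transpose i (i + 1)"
  by (auto simp: to_left_def fun_eq_iff transpose_def)

lemma to_right_n: "to_right n n = id"
  by (auto simp: to_right_def fun_eq_iff)

lemma to_right_Suc: "i < n \<Longrightarrow> to_right n i = to_right n (i + 1) \<circ> transpose i (i + 1)"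
  by (auto simp: to_right_def fun_eq_iff transpose_def)

lemma word_perm_to_left: "1 \<le> i \<Longrightarrow> word_perm [1..<i] = to_left i"
proof (induction i rule: dec_induct)
  case (step i)
  then show ?case
    using to_left_Suc[of i] word_perm_snoc[of "[1..<i]" i] by simp
qed (simp add: word_perm_Nil to_left_1[simplified])

lemma word_perm_to_right: "i \<le> n \<Longrightarrow> word_perm (rev [i..<n]) = to_right n i"
proof (induction i rule: inc_induct)
  case (step i)
  then show ?case
    using to_right_Suc[of i n] word_perm_snoc[of "rev [i + 1..<n]" i] by (simp add: upt_conv_Cons)
qed (simp add: word_perm_Nil to_right_n)

lemma word_perm_permutes: "set w \<subseteq> {1..<n} \<Longrightarrow> word_perm w permutes {1..n}"
  by (induction w)
    (auto simp: word_perm_Nil word_perm_Cons permutes_id intro!: permutes_compose permutes_swap_id)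

lemma to_left_permutes: "1 \<le> i \<Longrightarrow> i \<le> n \<Longrightarrow> to_left i permutes {1..n}"
  by (subst word_perm_to_left[symmetric]) (auto intro!: word_perm_permutes[simplified])

lemma to_right_permutes: "1 \<le> i \<Longrightarrow> i \<le> n \<Longrightarrow> to_right n i permutes {1..n}"
  by (subst word_perm_to_right[symmetric]) (auto intro!: word_perm_permutes[simplified])

lemma inv_to_left:
  assumes "1 \<le> i" "i \<le> n"
  shows "inv (to_left i) permutes {1..n}" "inv (to_left i) 1 = i"
    "strict_mono_on {2..n} (inv (to_left i))"
proof -
  note p = to_left_permutes[OF assms]
  show "inv (to_left i) permutes {1..n}" by (rule permutes_inv[OF p])
  show "inv (to_left i) 1 = i"
    unfolding permutes_inv_eq[OF p] by (simp add: to_left_def)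
  show "strict_mono_on {2..n} (inv (to_left i))"
  proof (rule strict_mono_onI)
    fix x y assume xy: "x \<in> {2..n}" "y \<in> {2..n}" "x < y"
    define a b where "a = inv (to_left i) x" and "b = inv (to_left i) y"
    have "to_left i a = x" "to_left i b = y"
      unfolding a_def b_def by (simp_all add: permutes_inverses[OF p])
    then show "inv (to_left i) x < inv (to_left i) y"
      unfolding a_def[symmetric] b_def[symmetric]
      using xy by (auto simp: to_left_def split: if_splits)
  qed
qed

lemma inv_to_right:
  assumes "1 \<le> i" "i \<le> Suc m"
  shows "inv (to_right (Suc m) i) permutes {1..Suc m}" "inv (to_right (Suc m) i) (Suc m) = i"
    "strict_mono_on {1..m} (inv (to_right (Suc m) i))"
proof -
  note p = to_right_permutes[OF assms]
  show "inv (to_right (Suc m) i) permutes {1..Suc m}" by (rule permutes_inv[OF p])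
  show "inv (to_right (Suc m) i) (Suc m) = i"
    unfolding permutes_inv_eq[OF p] by (simp add: to_right_def)
  show "strict_mono_on {1..m} (inv (to_right (Suc m) i))"
  proof (rule strict_mono_onI)
    fix x y assume xy: "x \<in> {1..m}" "y \<in> {1..m}" "x < y"
    define a b where "a = inv (to_right (Suc m) i) x" and "b = inv (to_right (Suc m) i) y"
    have "to_right (Suc m) i a = x" "to_right (Suc m) i b = y"
      unfolding a_def b_def by (simp_all add: permutes_inverses[OF p])
    then show "inv (to_right (Suc m) i) x < inv (to_right (Suc m) i) y"
      unfolding a_def[symmetric] b_def[symmetric]
      using xy by (auto simp: to_right_def split: if_splits)
  qed
qed

lemma Sh_1_left: "s \<in> Sh 1 m \<longleftrightarrow> s permutes {1..Suc m} \<and> strict_mono_on {2..Suc m} s"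
  by (auto simp: Sh_def numeral_2_eq_2 strict_mono_on_def)

lemma Sh_1_right: "s \<in> Sh m 1 \<longleftrightarrow> s permutes {1..Suc m} \<and> strict_mono_on {1..m} s"
  by (auto simp: Sh_def strict_mono_on_def)

text \<open>
  A shuffle of one element with the others is determined by the place \<open>i\<close> of this element, and its
  inverse brings the element at place \<open>i\<close> back to the front.
\<close>

lemma sum_Sh_left:
  "(\<Sum>s\<in>Sh 1 m. f (inv s)) = (\<Sum>i=1..Suc m. f (to_left i))"
proof (rule sum.reindex_bij_witness[where i = "\<lambda>i. inv (to_left i)" and j = "\<lambda>s. s 1"])
  fix s assume s: "s \<in> Sh 1 m"
  then have s': "s permutes {1..Suc m}" "strict_mono_on {2..Suc m} s"
    unfolding Sh_1_left by simp_all
  show i: "s 1 \<in> {1..Suc m}"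
    unfolding permutes_in_image[OF s'(1)] by simp
  have ins: "{1..Suc m} = insert 1 {2..Suc m}" by auto
  show eq: "inv (to_left (s 1)) = s"
    using s' i inv_to_left[of "s 1" "Suc m"] unfolding ins
    by (intro permutes_eqI_strict_mono_on[of _ 1 "{2..Suc m}"]) auto
  have "bij (to_left (s 1))"
    using i to_left_permutes[of "s 1" "Suc m"] permutes_bij by auto
  then show "f (to_left (s 1)) = f (inv s)"
    using eq inv_inv_eq by metis
next
  fix i assume i: "i \<in> {1..Suc m}"
  show "inv (to_left i) \<in> Sh 1 m" "inv (to_left i) 1 = i"
    using i inv_to_left[of i "Suc m"] unfolding Sh_1_left by simp_all
qed

lemma sum_Sh_right:
  "(\<Sum>s\<in>Sh m 1. f (inv s)) = (\<Sum>i=1..Suc m. f (to_right (Suc m) i))"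
proof (rule sum.reindex_bij_witness[where i = "\<lambda>i. inv (to_right (Suc m) i)" and j = "\<lambda>s. s (Suc m)"])
  fix s assume s: "s \<in> Sh m 1"
  then have s': "s permutes {1..Suc m}" "strict_mono_on {1..m} s"
    unfolding Sh_1_right by simp_all
  show i: "s (Suc m) \<in> {1..Suc m}"
    unfolding permutes_in_image[OF s'(1)] by simp
  have ins: "{1..Suc m} = insert (Suc m) {1..m}" by auto
  show eq: "inv (to_right (Suc m) (s (Suc m))) = s"
    using s' i inv_to_right[of "s (Suc m)" m] unfolding ins
    by (intro permutes_eqI_strict_mono_on[of _ "Suc m" "{1..m}"]) auto
  have "bij (to_right (Suc m) (s (Suc m)))"
    using i to_right_permutes[of "s (Suc m)" "Suc m"] permutes_bij by auto
  then show "f (to_right (Suc m) (s (Suc m))) = f (inv s)"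
    using eq inv_inv_eq by metis
next
  fix i assume i: "i \<in> {1..Suc m}"
  show "inv (to_right (Suc m) i) \<in> Sh m 1" "inv (to_right (Suc m) i) (Suc m) = i"
    using i inv_to_right[of i m] unfolding Sh_1_right by simp_all
qed

lemma foldr_comp_start:
  "foldr (\<lambda>i g. h i \<circ> g) w k = foldr (\<lambda>i g. h i \<circ> g) w id \<circ> k"
  by (induction w) (simp_all add: comp_assoc)

text \<open>
  \<open>T_perm\<close> picks an unspecified shortest word, which is known once it is unique.
\<close>

lemma T_perm_eqI:
  assumes "set w \<subseteq> {1..<n}" "word_perm w = s"
    and "\<And>w'. word_perm w' = s \<Longrightarrow> length w' \<le> length w \<Longrightarrow> w' = w"
  shows "T_perm scale \<beta> n s = foldr (\<lambda>i g. act_at scale 2 n i \<beta> \<circ> g) w id"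
proof -
  let ?Q = "\<lambda>w. set w \<subseteq> {1..<n} \<and> word_perm w = s"
  have "?Q w" using assms(1,2) by simp
  from arg_min_nat_lemma[of ?Q, OF this, of length] have "arg_min length ?Q = w"
    using assms(1,2) by (intro assms(3)) auto
  then show ?thesis unfolding T_perm_def by simp
qed

lemma T_perm_to_left:
  assumes "1 \<le> i" "i \<le> n"
  shows "T_perm scale \<beta> n (to_left i) = foldr (\<lambda>i g. act_at scale 2 n i \<beta> \<circ> g) [1..<i] id"
proof (rule T_perm_eqI)
  fix w assume "word_perm w = to_left i" "length w \<le> length [1..<i]"
  then show "w = [1..<i]"
    using assms by (intro word_going_down) (simp_all add: to_left_def)
qed (use assms word_perm_to_left in auto)

lemma T_perm_to_right:
  assumes "1 \<le> i" "i \<le> n"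
  shows "T_perm scale \<beta> n (to_right n i) = foldr (\<lambda>i g. act_at scale 2 n i \<beta> \<circ> g) (rev [i..<n]) id"
proof (rule T_perm_eqI)
  fix w assume "word_perm w = to_right n i" "length w \<le> length (rev [i..<n])"
  then show "w = rev [i..<n]"
    using assms by (intro word_going_up) (simp_all add: to_right_def)
qed (use assms word_perm_to_right in auto)

lemma T_perm_to_left_1: "1 \<le> n \<Longrightarrow> T_perm scale \<beta> n (to_left 1) = id"
  by (subst T_perm_to_left) simp_all

lemma T_perm_to_left_Suc:
  assumes "1 \<le> i" "i < n"
  shows "T_perm scale \<beta> n (to_left (Suc i)) = T_perm scale \<beta> n (to_left i) \<circ> act_at scale 2 n i \<beta>"
  using assms
  by (simp add: T_perm_to_left foldr_comp_start[where k = "act_at scale 2 n i \<beta>"])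

lemma T_perm_to_right_n: "1 \<le> n \<Longrightarrow> T_perm scale \<beta> n (to_right n n) = id"
  by (subst T_perm_to_right) simp_all

lemma T_perm_to_right_Suc:
  assumes "1 \<le> i" "i < n"
  shows "T_perm scale \<beta> n (to_right n i) = T_perm scale \<beta> n (to_right n (Suc i)) \<circ> act_at scale 2 n i \<beta>"
  using assms
  by (simp add: T_perm_to_right upt_conv_Cons foldr_comp_start[where k = "act_at scale 2 n i \<beta>"])


section \<open>Faces of the tensor powers of a pre-braided space\<close>

locale pre_braided_space = tensor_powers scale
  for scale :: "'k::field \<Rightarrow> 'v::ab_group_add \<Rightarrow> 'v" +
  fixes \<sigma> :: "('k, 'v) tensor \<Rightarrow> ('k, 'v) tensor"
  assumes pre_braiding: "pre_braiding scale \<sigma>"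
begin

abbreviation S :: "nat \<Rightarrow> nat \<Rightarrow> ('k, 'v) tensor \<Rightarrow> ('k, 'v) tensor" where
  "S n i \<equiv> act_at scale 2 n i \<sigma>"

abbreviation apply_form :: "('v \<Rightarrow> 'k) \<Rightarrow> nat \<Rightarrow> nat \<Rightarrow> ('k, 'v) tensor \<Rightarrow> ('k, 'v) tensor" where
  "apply_form \<epsilon> n i \<equiv> act_at scale 1 n i (form_map scale \<epsilon>)"

abbreviation L :: "('v \<Rightarrow> 'k) \<Rightarrow> nat \<Rightarrow> nat \<Rightarrow> ('k, 'v) tensor \<Rightarrow> ('k, 'v) tensor" where
  "L \<equiv> left_face scale \<sigma>"

abbreviation R :: "('v \<Rightarrow> 'k) \<Rightarrow> nat \<Rightarrow> nat \<Rightarrow> ('k, 'v) tensor \<Rightarrow> ('k, 'v) tensor" where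
  "R \<equiv> right_face scale \<sigma>"

abbreviation form :: "('v \<Rightarrow> 'k) \<Rightarrow> bool" where
  "form \<equiv> Vector_Spaces.linear scale (*)"

lemma lin_sigma: "lin 2 2 \<sigma>"
  using pre_braiding by (simp add: pre_braiding_def)

lemma lin_S: "1 \<le> i \<Longrightarrow> i < n \<Longrightarrow> lin n n (S n i)"
  by (rule lin_act[OF lin_sigma]) simp_all

lemmas S_in = lin_in[OF lin_S]

lemma lin_apply_form: "form \<epsilon> \<Longrightarrow> 1 \<le> i \<Longrightarrow> i \<le> Suc n \<Longrightarrow> lin (Suc n) n (apply_form \<epsilon> (Suc n) i)"
  by (rule lin_act[OF lin_form_map]) simp_all

lemma yang_baxter:
  assumes "1 \<le> i" "i + 2 \<le> n" and t: "t \<in> W n"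
  shows "S n i (S n (Suc i) (S n i t)) = S n (Suc i) (S n i (S n (Suc i) t))"
proof -
  define p q where "p = i - 1" and "q = n - i - 2"
  have n: "n = p + (3 + q)" and i: "i = p + 1" "Suc i = p + 2"
    using assms by (simp_all add: p_def q_def)
  have li: "lin n n (S n i)" and lsi: "lin n n (S n (Suc i))"
    using assms by (simp_all add: lin_S)
  note lin1 = lin_comp[OF lin_comp[OF li lsi] li] and lin2 = lin_comp[OF lin_comp[OF lsi li] lsi]
  show ?thesis
  proof (rule lin_eqI3[OF n lin1 lin2 _ t])
    fix u x w assume u: "u \<in> W p" and x: "x \<in> W 3" and w: "w \<in> W q"
    have 1: "S n i (u \<otimes> y \<otimes> w) = u \<otimes> S 3 1 y \<otimes> w" if "y \<in> W 3" for y
      by (rule act_at_inside[OF lin_sigma _ _ u that w n i(1)]) simp_all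
    have 2: "S n (Suc i) (u \<otimes> y \<otimes> w) = u \<otimes> S 3 2 y \<otimes> w" if "y \<in> W 3" for y
      by (rule act_at_inside[OF lin_sigma _ _ u that w n i(2)]) simp_all
    have "S 3 1 (S 3 2 (S 3 1 x)) = S 3 2 (S 3 1 (S 3 2 x))"
      using pre_braiding x by (simp add: pre_braiding_def Let_def)
    then show "S n i (S n (Suc i) (S n i (u \<otimes> x \<otimes> w))) =
        S n (Suc i) (S n i (S n (Suc i) (u \<otimes> x \<otimes> w)))"
      using x by (simp add: 1 2 S_in)
  qed
qed

lemma L_1: "1 \<le> n \<Longrightarrow> L \<epsilon> n 1 t = apply_form \<epsilon> n 1 t"
  unfolding left_face_def by (subst T_perm_to_left_1) simp_all

lemma L_Suc: "1 \<le> i \<Longrightarrow> i < n \<Longrightarrow> L \<epsilon> n (Suc i) t = L \<epsilon> n i (S n i t)"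
  by (simp add: left_face_def T_perm_to_left_Suc)

lemma R_n: "1 \<le> n \<Longrightarrow> R \<zeta> n n t = apply_form \<zeta> n n t"
  by (simp add: right_face_def T_perm_to_right_n)

lemma R_Suc: "1 \<le> i \<Longrightarrow> i < n \<Longrightarrow> R \<zeta> n i t = R \<zeta> n (Suc i) (S n i t)"
  by (simp add: right_face_def T_perm_to_right_Suc)

lemma lin_L:
  assumes \<epsilon>: "form \<epsilon>" and "1 \<le> i" "i \<le> Suc n"
  shows "lin (Suc n) n (L \<epsilon> (Suc n) i)"
  using assms(2,3)
proof (induction i rule: dec_induct)
  case base
  have "L \<epsilon> (Suc n) 1 = apply_form \<epsilon> (Suc n) 1"
    by (rule ext, rule L_1) simp
  then show ?case
    using lin_apply_form[OF \<epsilon>] by simp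
next
  case (step i)
  have "L \<epsilon> (Suc n) (Suc i) = (\<lambda>t. L \<epsilon> (Suc n) i (S (Suc n) i t))"
    by (rule ext, rule L_Suc) (use step in simp_all)
  moreover have "lin (Suc n) n (\<lambda>t. L \<epsilon> (Suc n) i (S (Suc n) i t))"
    by (rule lin_comp[OF lin_S]) (use step in simp_all)
  ultimately show ?case by simp
qed

lemma lin_R:
  assumes \<zeta>: "form \<zeta>" and "1 \<le> i" "i \<le> Suc n"
  shows "lin (Suc n) n (R \<zeta> (Suc n) i)"
  using assms(3,2)
proof (induction i rule: inc_induct)
  case base
  have "R \<zeta> (Suc n) (Suc n) = apply_form \<zeta> (Suc n) (Suc n)"
    by (rule ext, rule R_n) simp
  then show ?case
    using lin_apply_form[OF \<zeta>] by simp
next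
  case (step i)
  have "R \<zeta> (Suc n) i = (\<lambda>t. R \<zeta> (Suc n) (Suc i) (S (Suc n) i t))"
    by (rule ext, rule R_Suc) (use step in simp_all)
  moreover have "lin (Suc n) n (\<lambda>t. R \<zeta> (Suc n) (Suc i) (S (Suc n) i t))"
    by (rule lin_comp[OF lin_S]) (use step in simp_all)
  ultimately show ?case by simp
qed

text \<open>
  The operator acts to the right of the strand that is pulled, and only loses one place when that
  strand disappears.
\<close>

lemma L_natural:
  assumes \<epsilon>: "form \<epsilon>" and \<phi>: "lin l r \<phi>"
    and i: "1 \<le> i" "i \<le> j" and j: "j + l \<le> n + 1" and m: "m + l = n + r"
    and t: "t \<in> W (Suc n)"
  shows "L \<epsilon> (Suc m) i (act_at scale l (Suc n) (Suc j) \<phi> t) =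
    act_at scale l n j \<phi> (L \<epsilon> (Suc n) i t)"
  using i t
proof (induction i arbitrary: t rule: dec_induct)
  case base
  show ?case
    using act_at_commute[OF lin_form_map[OF \<epsilon>] \<phi>, of 1 "Suc j" "Suc n" "Suc m" n j t] base i j m
      L_1[of "Suc m" \<epsilon>] L_1[of "Suc n" \<epsilon>]
    by simp
next
  case (step i)
  have "S (Suc m) i (act_at scale l (Suc n) (Suc j) \<phi> t) =
      act_at scale l (Suc n) (Suc j) \<phi> (S (Suc n) i t)"
    by (rule act_at_commute[OF lin_sigma \<phi>]) (use step j m in simp_all)
  then show ?case
    using step.IH[of "S (Suc n) i t"] step j m by (simp add: L_Suc S_in)
qed

text \<open>
  The pulled strand starts to the right of the operator and meets it on its way.  If the operator can
  be slid through for the nearest starting place (the assumption), it can be for all farther ones: the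
  additional crossings happen away from the operator.
\<close>

lemma L_past:
  assumes \<phi>: "lin l r \<phi>"
    and j: "1 \<le> j" and m: "m + l = n + r"
    and cross: "\<And>t. t \<in> W (Suc n) \<Longrightarrow>
      L \<epsilon> (Suc m) (j + r) (act_at scale l (Suc n) j \<phi> t) =
        act_at scale l n j \<phi> (L \<epsilon> (Suc n) (j + l) t)"
    and k: "j + l + k \<le> Suc n" and t: "t \<in> W (Suc n)"
  shows "L \<epsilon> (Suc m) (j + r + k) (act_at scale l (Suc n) j \<phi> t) =
    act_at scale l n j \<phi> (L \<epsilon> (Suc n) (j + l + k) t)"
  using k t
proof (induction k arbitrary: t)
  case (Suc k)
  have "act_at scale l (Suc n) j \<phi> (S (Suc n) (j + l + k) t) =
      S (Suc m) (j + r + k) (act_at scale l (Suc n) j \<phi> t)"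
    by (rule act_at_commute[OF \<phi> lin_sigma]) (use Suc.prems j m in simp_all)
  then show ?case
    using Suc.IH[of "S (Suc n) (j + l + k) t"] Suc.prems j m by (simp add: L_Suc S_in)
qed (simp add: cross)

text \<open>
  The number \<open>i'\<close> is the index \<open>i\<close> of the strand after the operator on its left has
  changed the number of factors.
\<close>

lemma R_natural:
  assumes \<zeta>: "form \<zeta>" and \<phi>: "lin l r \<phi>"
    and j: "1 \<le> j" "j + l \<le> i" and i: "i \<le> Suc n" and m: "m + l = n + r" "i' + l = i + r"
    and t: "t \<in> W (Suc n)"
  shows "R \<zeta> (Suc m) i' (act_at scale l (Suc n) j \<phi> t) =
    act_at scale l n j \<phi> (R \<zeta> (Suc n) i t)"
  using i j m t
proof (induction i arbitrary: t i' rule: inc_induct)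
  case base
  then have i': "i' = Suc m" by simp
  then show ?case
    using act_at_commute[OF \<phi> lin_form_map[OF \<zeta>], of j "Suc n" "Suc n" n "Suc m" "Suc m" t] base
    unfolding i' by (simp add: R_n)
next
  case (step i)
  have "act_at scale l (Suc n) j \<phi> (S (Suc n) i t) = S (Suc m) i' (act_at scale l (Suc n) j \<phi> t)"
    by (rule act_at_commute[OF \<phi> lin_sigma]) (use step in simp_all)
  then show ?case
    using step.IH[where t = "S (Suc n) i t" and i' = "Suc i'"] step by (simp add: R_Suc S_in)
qed

lemma R_past:
  assumes \<phi>: "lin l r \<phi>"
    and i: "1 \<le> i" "i \<le> j" and j: "j + l \<le> n + 1" and m: "m + l = n + r"
    and cross: "\<And>t. t \<in> W (Suc n) \<Longrightarrow>
      R \<zeta> (Suc m) j (act_at scale l (Suc n) (Suc j) \<phi> t) =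
        act_at scale l n j \<phi> (R \<zeta> (Suc n) j t)"
    and t: "t \<in> W (Suc n)"
  shows "R \<zeta> (Suc m) i (act_at scale l (Suc n) (Suc j) \<phi> t) =
    act_at scale l n j \<phi> (R \<zeta> (Suc n) i t)"
  using i(2,1) t
proof (induction i arbitrary: t rule: inc_induct)
  case (step i)
  have "S (Suc m) i (act_at scale l (Suc n) (Suc j) \<phi> t) =
      act_at scale l (Suc n) (Suc j) \<phi> (S (Suc n) i t)"
    by (rule act_at_commute[OF lin_sigma \<phi>]) (use step j m in simp_all)
  then show ?case
    using step.IH[where t = "S (Suc n) i t"] step j m by (simp add: R_Suc S_in)
qed (simp add: cross)

lemma R_past_S:
  assumes \<zeta>: "form \<zeta>" and j: "1 \<le> i" "i \<le> j" "j < n" and t: "t \<in> W (Suc n)"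
  shows "R \<zeta> (Suc n) i (S (Suc n) (Suc j) t) = S n j (R \<zeta> (Suc n) i t)"
proof (rule R_past[OF lin_sigma j(1,2) _ refl _ t])
  fix t assume t: "t \<in> W (Suc n)"
  have "R \<zeta> (Suc n) j (S (Suc n) (Suc j) t) =
      R \<zeta> (Suc n) (j + 2) (S (Suc n) (Suc j) (S (Suc n) j (S (Suc n) (Suc j) t)))"
    using j by (simp add: R_Suc)
  also have "\<dots> = R \<zeta> (Suc n) (j + 2) (S (Suc n) j (S (Suc n) (Suc j) (S (Suc n) j t)))"
    using j t by (simp add: yang_baxter)
  also have "\<dots> = S n j (R \<zeta> (Suc n) (j + 2) (S (Suc n) (Suc j) (S (Suc n) j t)))"
    by (rule R_natural[OF \<zeta> lin_sigma]) (use j t in \<open>simp_all add: S_in\<close>)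
  also have "\<dots> = S n j (R \<zeta> (Suc n) j t)"
    using j by (simp add: R_Suc)
  finally show "R \<zeta> (Suc n) j (S (Suc n) (Suc j) t) = S n j (R \<zeta> (Suc n) j t)" .
qed (use j in simp)

text \<open>
  When two neighbouring strands are killed, a crossing before them can be absorbed at the price of
  exchanging the forms.
\<close>

lemma apply_forms_S:
  assumes \<epsilon>: "form \<epsilon>" and \<zeta>: "form \<zeta>"
    and compat: "\<And>x. x \<in> W 2 \<Longrightarrow> form_prod \<zeta> \<epsilon> (\<sigma> x) = form_prod \<epsilon> \<zeta> x"
    and i: "1 \<le> i" "i \<le> Suc n" and t: "t \<in> W (Suc (Suc n))"
  shows "apply_form \<epsilon> (Suc n) i (apply_form \<zeta> (Suc (Suc n)) i (S (Suc (Suc n)) i t)) =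
    apply_form \<zeta> (Suc n) i (apply_form \<epsilon> (Suc (Suc n)) i t)"
proof -
  define p q where "p = i - 1" and "q = Suc n - i"
  have n: "Suc (Suc n) = p + (2 + q)" "Suc n = p + (1 + q)" and i': "i = p + 1"
    using i by (simp_all add: p_def q_def)
  have lS: "lin (Suc (Suc n)) (Suc (Suc n)) (S (Suc (Suc n)) i)"
    using i by (simp add: lin_S)
  have lf: "lin (Suc (Suc n)) (Suc n) (apply_form \<eta> (Suc (Suc n)) i)" if "form \<eta>" for \<eta>
    by (rule lin_apply_form[OF that]) (use i in simp_all)
  have lf': "lin (Suc n) n (apply_form \<eta> (Suc n) i)" if "form \<eta>" for \<eta>
    by (rule lin_apply_form[OF that]) (use i in simp_all)
  have l2: "lin 2 1 (apply_form \<eta> 2 1)" if "form \<eta>" for \<eta>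
    by (rule lin_act[OF lin_form_map[OF that]]) simp_all
  note lin1 = lin_comp[OF lin_comp[OF lS lf[OF \<zeta>]] lf'[OF \<epsilon>]]
    and lin2 = lin_comp[OF lf[OF \<epsilon>] lf'[OF \<zeta>]]
  show ?thesis
  proof (rule lin_eqI3[OF n(1) lin1 lin2 _ t])
    fix u x w assume u: "u \<in> W p" and x: "x \<in> W 2" and w: "w \<in> W q"
    have 1: "S (Suc (Suc n)) i (u \<otimes> x \<otimes> w) = u \<otimes> \<sigma> x \<otimes> w"
      by (rule act_at_inside_full[OF lin_sigma u x w n(1) i'])
    have 2: "apply_form \<eta> (Suc (Suc n)) i (u \<otimes> y \<otimes> w) = u \<otimes> apply_form \<eta> 2 1 y \<otimes> w"
      if "y \<in> W 2" "form \<eta>" for y \<eta>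
      by (rule act_at_inside[OF lin_form_map _ _ u _ w n(1) i']) (use that in simp_all)
    have 3: "apply_form \<eta> (Suc n) i (u \<otimes> y \<otimes> w) = u \<otimes> form_map scale \<eta> y \<otimes> w"
      if "y \<in> W 1" "form \<eta>" for y \<eta>
      by (rule act_at_inside_full[OF lin_form_map u _ w n(2) i']) (use that in simp_all)
    have "form_map scale \<epsilon> (apply_form \<zeta> 2 1 (\<sigma> x)) = form_map scale \<zeta> (apply_form \<epsilon> 2 1 x)"
      unfolding form_map_twice[OF \<zeta> \<epsilon> lin_in[OF lin_sigma x]] form_map_twice[OF \<epsilon> \<zeta> x] compat[OF x] ..
    then show "apply_form \<epsilon> (Suc n) i
        (apply_form \<zeta> (Suc (Suc n)) i (S (Suc (Suc n)) i (u \<otimes> x \<otimes> w))) =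
      apply_form \<zeta> (Suc n) i (apply_form \<epsilon> (Suc (Suc n)) i (u \<otimes> x \<otimes> w))"
      using x \<epsilon> \<zeta> lin_in[OF lin_sigma x] lin_in[OF l2] by (simp only: 1 2 3)
  qed
qed

text \<open>
  If the second strand starts at a distance, its first crossings do not involve the first strand, so
  that only neighbouring strands matter.  Pulling these from \<open>i\<close> and \<open>i + 1\<close> in the two possible
  orders gives diagrams related by the Yang--Baxter equation, up to a final crossing of the two killed
  strands.
\<close>

lemma L_L:
  assumes \<epsilon>: "form \<epsilon>" and \<zeta>: "form \<zeta>"
    and compat: "\<And>x. x \<in> W 2 \<Longrightarrow> form_prod \<zeta> \<epsilon> (\<sigma> x) = form_prod \<epsilon> \<zeta> x"
    and ij: "1 \<le> i" "i \<le> j" "j \<le> Suc n" and t: "t \<in> W (Suc (Suc n))"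
  shows "L \<epsilon> (Suc n) i (L \<zeta> (Suc (Suc n)) (Suc j) t) = L \<zeta> (Suc n) j (L \<epsilon> (Suc (Suc n)) i t)"
  using ij(2,3) t
proof (induction j arbitrary: t rule: dec_induct)
  case base
  show ?case
    using ij(1) base
  proof (induction i arbitrary: t rule: dec_induct)
    case base
    have "L \<epsilon> (Suc n) 1 (L \<zeta> (Suc (Suc n)) (Suc 1) t) =
        apply_form \<epsilon> (Suc n) 1 (apply_form \<zeta> (Suc (Suc n)) 1 (S (Suc (Suc n)) 1 t))"
      by (simp only: L_1 L_Suc)
    then show ?case
      using apply_forms_S[OF \<epsilon> \<zeta> compat _ _ base(2), of 1]
        L_1[of "Suc n" \<zeta>] L_1[of "Suc (Suc n)" \<epsilon>] by simp
  next
    case (step i)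
    let ?N = "Suc (Suc n)"
    have "L \<epsilon> (Suc n) (Suc i) (L \<zeta> ?N (Suc (Suc i)) t) =
        L \<epsilon> (Suc n) i (S (Suc n) i (L \<zeta> ?N i (S ?N i (S ?N (Suc i) t))))"
      using step by (simp add: L_Suc)
    \<comment> \<open>Move the crossing of the outer face to the front, where the Yang--Baxter equation applies.\<close>
    also have "S (Suc n) i (L \<zeta> ?N i (S ?N i (S ?N (Suc i) t))) =
        L \<zeta> ?N i (S ?N (Suc i) (S ?N i (S ?N (Suc i) t)))"
      by (rule L_natural[OF \<zeta> lin_sigma, symmetric]) (use step in \<open>simp_all add: S_in\<close>)
    also have "\<dots> = L \<zeta> ?N (Suc i) (S ?N (Suc i) (S ?N i t))"
      using step by (simp add: yang_baxter[symmetric] L_Suc)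
    also have "L \<epsilon> (Suc n) i \<dots> = L \<zeta> (Suc n) i (L \<epsilon> ?N i (S ?N (Suc i) (S ?N i t)))"
      by (rule step.IH) (use step in \<open>simp_all add: S_in\<close>)
    also have "L \<epsilon> ?N i (S ?N (Suc i) (S ?N i t)) = S (Suc n) i (L \<epsilon> ?N i (S ?N i t))"
      by (rule L_natural[OF \<epsilon> lin_sigma]) (use step in \<open>simp_all add: S_in\<close>)
    also have "L \<zeta> (Suc n) i \<dots> = L \<zeta> (Suc n) (Suc i) (L \<epsilon> ?N (Suc i) t)"
      using step by (simp add: L_Suc)
    finally show ?case .
  qed
next
  case (step j)
  have "L \<epsilon> (Suc (Suc n)) i (S (Suc (Suc n)) (Suc j) t) = S (Suc n) j (L \<epsilon> (Suc (Suc n)) i t)"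
    by (rule L_natural[OF \<epsilon> lin_sigma]) (use step ij in simp_all)
  then show ?case
    using step.IH[of "S (Suc (Suc n)) (Suc j) t"] step ij by (simp add: L_Suc S_in)
qed

text \<open>
  The mirror image of the argument for left faces, for a single form.
\<close>

lemma R_R:
  assumes \<zeta>: "form \<zeta>"
    and char: "\<And>x. x \<in> W 2 \<Longrightarrow> form_prod \<zeta> \<zeta> (\<sigma> x) = form_prod \<zeta> \<zeta> x"
    and ij: "1 \<le> i" "i \<le> j" "j \<le> Suc n" and t: "t \<in> W (Suc (Suc n))"
  shows "R \<zeta> (Suc n) i (R \<zeta> (Suc (Suc n)) (Suc j) t) = R \<zeta> (Suc n) j (R \<zeta> (Suc (Suc n)) i t)"
  using ij(2,1) t
proof (induction i arbitrary: t rule: inc_induct)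
  case base
  let ?N = "Suc (Suc n)"
  show ?case
    using ij(3) base
  proof (induction j arbitrary: t rule: inc_induct)
    case base
    \<comment> \<open>The two last factors can be killed in either order; this brings the forms into the position
      where the crossing is absorbed.\<close>
    have comm: "apply_form \<zeta> (Suc n) (Suc n) (apply_form \<zeta> ?N ?N x) =
        apply_form \<zeta> (Suc n) (Suc n) (apply_form \<zeta> ?N (Suc n) x)" if "x \<in> W ?N" for x
      by (rule act_at_commute[OF lin_form_map[OF \<zeta>] lin_form_map[OF \<zeta>]]) (use that in simp_all)
    have t: "t \<in> W ?N" by (rule base)
    have St: "S ?N (Suc n) t \<in> W ?N" by (rule S_in[OF _ _ t]) simp_all
    have R1: "R \<zeta> (Suc n) (Suc n) y = apply_form \<zeta> (Suc n) (Suc n) y"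
      and R2: "R \<zeta> ?N ?N y = apply_form \<zeta> ?N ?N y"
      and R3: "R \<zeta> ?N (Suc n) y = R \<zeta> ?N ?N (S ?N (Suc n) y)" for y
      by (rule R_n R_Suc; simp)+
    have "apply_form \<zeta> (Suc n) (Suc n) (apply_form \<zeta> ?N (Suc n) (S ?N (Suc n) t)) =
        apply_form \<zeta> (Suc n) (Suc n) (apply_form \<zeta> ?N (Suc n) t)"
      by (rule apply_forms_S[OF \<zeta> \<zeta> char _ _ t]) simp_all
    then show ?case
      by (simp only: R3 R2 R1 comm[OF t] comm[OF St])
  next
    case (step j)
    have S_mem: "S ?N j x \<in> W ?N" "S ?N (Suc j) x \<in> W ?N" if "x \<in> W ?N" for x
      by (rule S_in[OF _ _ that]; use step.hyps step.prems(1) in simp)+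
    have R1: "R \<zeta> (Suc n) j y = R \<zeta> (Suc n) (Suc j) (S (Suc n) j y)"
      and R2: "R \<zeta> ?N j y = R \<zeta> ?N (Suc j) (S ?N j y)"
      and R3: "R \<zeta> ?N (Suc j) y = R \<zeta> ?N (Suc (Suc j)) (S ?N (Suc j) y)" for y
      by (rule R_Suc; use step.hyps step.prems(1) in simp)+
    have IH: "R \<zeta> (Suc n) (Suc j) (R \<zeta> ?N (Suc (Suc j)) (S ?N (Suc j) x)) =
        R \<zeta> (Suc n) (Suc j) (R \<zeta> ?N (Suc (Suc j)) x)" if "x \<in> W ?N" for x
      unfolding R3[symmetric] by (rule step.IH[OF _ that, symmetric]) simp
    have swap: "S (Suc n) j (R \<zeta> ?N (Suc (Suc j)) x) = R \<zeta> ?N (Suc (Suc j)) (S ?N j x)"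
      if "x \<in> W ?N" for x
      by (rule R_natural[OF \<zeta> lin_sigma, symmetric])
        (use step.hyps step.prems(1) that in simp_all)
    have YB: "S ?N j (S ?N (Suc j) (S ?N j t)) = S ?N (Suc j) (S ?N j (S ?N (Suc j) t))"
      by (rule yang_baxter) (use step.hyps step.prems in simp_all)
    have "R \<zeta> (Suc n) j (R \<zeta> ?N j t) =
        R \<zeta> (Suc n) (Suc j) (S (Suc n) j (R \<zeta> ?N (Suc (Suc j)) (S ?N (Suc j) (S ?N j t))))"
      by (simp only: R1 R2 R3)
    also have "\<dots> = R \<zeta> (Suc n) (Suc j)
        (R \<zeta> ?N (Suc (Suc j)) (S ?N (Suc j) (S ?N j (S ?N (Suc j) t))))"
      by (simp only: swap S_mem step.prems YB)
    also have "\<dots> = R \<zeta> (Suc n) (Suc j) (R \<zeta> ?N (Suc (Suc j)) (S ?N j (S ?N (Suc j) t)))"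
      by (simp only: IH S_mem step.prems)
    also have "\<dots> = R \<zeta> (Suc n) j (R \<zeta> ?N (Suc j) t)"
      by (simp only: swap[symmetric] R1 R3 S_mem step.prems)
    finally show ?case by (rule sym)
  qed
next
  case (step i)
  have "R \<zeta> (Suc (Suc n)) (Suc j) (S (Suc (Suc n)) i t) =
      S (Suc n) i (R \<zeta> (Suc (Suc n)) (Suc j) t)"
    by (rule R_natural[OF \<zeta> lin_sigma]) (use step ij in simp_all)
  then show ?case
    using step.IH[of "S (Suc (Suc n)) i t"] step ij by (simp add: R_Suc S_in)
qed

text \<open>
  The strand pulled to the right starts on the right of the other one, so they never meet.
\<close>

lemma L_R:
  assumes \<epsilon>: "form \<epsilon>" and \<zeta>: "form \<zeta>"
    and ij: "1 \<le> i" "i \<le> j" "j \<le> Suc n" and t: "t \<in> W (Suc (Suc n))"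
  shows "L \<epsilon> (Suc n) i (R \<zeta> (Suc (Suc n)) (Suc j) t) = R \<zeta> (Suc n) j (L \<epsilon> (Suc (Suc n)) i t)"
  using ij(3,2) t
proof (induction j arbitrary: t rule: inc_induct)
  case base
  have "L \<epsilon> (Suc n) i (apply_form \<zeta> (Suc (Suc n)) (Suc (Suc n)) t) =
      apply_form \<zeta> (Suc n) (Suc n) (L \<epsilon> (Suc (Suc n)) i t)"
    by (rule L_natural[OF \<epsilon> lin_form_map[OF \<zeta>]]) (use base ij in simp_all)
  then show ?case by (simp add: R_n)
next
  case (step j)
  have "L \<epsilon> (Suc (Suc n)) i (S (Suc (Suc n)) (Suc j) t) = S (Suc n) j (L \<epsilon> (Suc (Suc n)) i t)"
    by (rule L_natural[OF \<epsilon> lin_sigma]) (use step ij in simp_all)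
  then show ?case
    using step.IH[of "S (Suc (Suc n)) (Suc j) t"] step ij by (simp add: R_Suc S_in)
qed

text \<open>
  Here the two strands cross exactly once.  For neighbouring strands the crossing can be done first,
  which leaves two strands that no longer meet.
\<close>

lemma R_L:
  assumes \<epsilon>: "form \<epsilon>" and \<zeta>: "form \<zeta>"
    and ij: "1 \<le> i" "i \<le> j" "j \<le> Suc n" and t: "t \<in> W (Suc (Suc n))"
  shows "R \<zeta> (Suc n) i (L \<epsilon> (Suc (Suc n)) (Suc j) t) = L \<epsilon> (Suc n) j (R \<zeta> (Suc (Suc n)) i t)"
  using ij(2,3) t
proof (induction j arbitrary: t rule: dec_induct)
  case base
  have "L \<epsilon> (Suc n) i (R \<zeta> (Suc (Suc n)) (Suc i) (S (Suc (Suc n)) i t)) =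
      R \<zeta> (Suc n) i (L \<epsilon> (Suc (Suc n)) i (S (Suc (Suc n)) i t))"
    by (rule L_R[OF \<epsilon> \<zeta>]) (use base ij in \<open>simp_all add: S_in\<close>)
  then show ?case
    using base ij by (simp add: L_Suc R_Suc[of i "Suc (Suc n)"])
next
  case (step j)
  have "R \<zeta> (Suc (Suc n)) i (S (Suc (Suc n)) (Suc j) t) = S (Suc n) j (R \<zeta> (Suc (Suc n)) i t)"
    by (rule R_past_S[OF \<zeta>]) (use step ij in simp_all)
  then show ?case
    using step.IH[of "S (Suc (Suc n)) (Suc j) t"] step ij by (simp add: L_Suc S_in)
qed


section \<open>Degeneracies\<close>

lemma lin_comult:
  assumes "coassociative scale \<Delta>"
  shows "lin 1 2 (comult_map \<Delta>)"
  using assms by (intro lin_comult_map) (simp_all add: coassociative_def)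

lemma coassociative_at:
  assumes \<Delta>: "coassociative scale \<Delta>" and i: "1 \<le> i" "i \<le> n" and t: "t \<in> W n"
  shows "degeneracy scale \<Delta> (Suc n) i (degeneracy scale \<Delta> n i t) =
    degeneracy scale \<Delta> (Suc n) (Suc i) (degeneracy scale \<Delta> n i t)"
proof -
  note \<delta> = lin_comult[OF \<Delta>]
  define p q where "p = i - 1" and "q = n - i"
  have n: "n = p + (1 + q)" "Suc n = p + (2 + q)" and i': "i = p + 1" "Suc i = p + 2"
    using i by (simp_all add: p_def q_def)
  have lin1: "lin n (Suc n) (degeneracy scale \<Delta> n i)"
    and lin2: "lin (Suc n) (Suc (Suc n)) (degeneracy scale \<Delta> (Suc n) i)"
      "lin (Suc n) (Suc (Suc n)) (degeneracy scale \<Delta> (Suc n) (Suc i))"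
    unfolding degeneracy_def by (rule lin_act[OF \<delta>]; use i in simp)+
  show ?thesis
  proof (rule lin_eqI3[OF n(1) lin_comp[OF lin1 lin2(1)] lin_comp[OF lin1 lin2(2)] _ t])
    fix u x w assume u: "u \<in> W p" and x: "x \<in> W 1" and w: "w \<in> W q"
    let ?\<delta> = "comult_map \<Delta>"
    have \<delta>x: "?\<delta> x \<in> W 2" by (rule lin_in[OF \<delta> x])
    have 0: "degeneracy scale \<Delta> n i (u \<otimes> x \<otimes> w) = u \<otimes> ?\<delta> x \<otimes> w"
      unfolding degeneracy_def by (rule act_at_inside_full[OF \<delta> u x w n(1) i'(1)])
    have 1: "degeneracy scale \<Delta> (Suc n) i (u \<otimes> ?\<delta> x \<otimes> w) = u \<otimes> act_at scale 1 2 1 ?\<delta> (?\<delta> x) \<otimes> w"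
      unfolding degeneracy_def by (rule act_at_inside[OF \<delta> _ _ u \<delta>x w n(2) i'(1)]) simp_all
    have 2: "degeneracy scale \<Delta> (Suc n) (Suc i) (u \<otimes> ?\<delta> x \<otimes> w) =
        u \<otimes> act_at scale 1 2 2 ?\<delta> (?\<delta> x) \<otimes> w"
      unfolding degeneracy_def by (rule act_at_inside[OF \<delta> _ _ u \<delta>x w n(2) i'(2)]) simp_all
    have l: "lin 2 3 (act_at scale 1 2 1 ?\<delta>)" "lin 2 3 (act_at scale 1 2 2 ?\<delta>)"
      by (rule lin_act[OF \<delta>]; simp)+
    have "act_at scale 1 2 1 ?\<delta> (?\<delta> x) = act_at scale 1 2 2 ?\<delta> (?\<delta> x)"
    proof (rule lin_eqI[OF lin_comp[OF \<delta> l(1)] lin_comp[OF \<delta> l(2)] _ x])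
      fix xs :: "'v list" assume "length xs = 1"
      then obtain v where "xs = [v]" by (auto simp: length_Suc_conv)
      then show "act_at scale 1 2 1 ?\<delta> (?\<delta> (P xs)) = act_at scale 1 2 2 ?\<delta> (?\<delta> (P xs))"
        using \<Delta> by (simp add: coassociative_def comult_map_pure)
    qed
    then show "degeneracy scale \<Delta> (Suc n) i (degeneracy scale \<Delta> n i (u \<otimes> x \<otimes> w)) =
        degeneracy scale \<Delta> (Suc n) (Suc i) (degeneracy scale \<Delta> n i (u \<otimes> x \<otimes> w))"
      by (simp only: 0 1 2)
  qed
qed

lemma cocommutative_at:
  assumes \<Delta>: "coassociative scale \<Delta>" and cocomm: "sigma_cocommutative \<sigma> \<Delta>"
    and i: "1 \<le> i" "i \<le> n" and t: "t \<in> W n"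
  shows "S (Suc n) i (degeneracy scale \<Delta> n i t) = degeneracy scale \<Delta> n i t"
proof -
  note \<delta> = lin_comult[OF \<Delta>]
  define p q where "p = i - 1" and "q = n - i"
  have n: "n = p + (1 + q)" "Suc n = p + (2 + q)" and i': "i = p + 1"
    using i by (simp_all add: p_def q_def)
  have lD: "lin n (Suc n) (degeneracy scale \<Delta> n i)"
    unfolding degeneracy_def by (rule lin_act[OF \<delta>]) (use i in simp_all)
  have lS: "lin (Suc n) (Suc n) (S (Suc n) i)"
    using i by (simp add: lin_S)
  show ?thesis
  proof (rule lin_eqI3[OF n(1) lin_comp[OF lD lS] lD _ t])
    fix u x w assume u: "u \<in> W p" and x: "x \<in> W 1" and w: "w \<in> W q"
    let ?\<delta> = "comult_map \<Delta>"
    have 0: "degeneracy scale \<Delta> n i (u \<otimes> x \<otimes> w) = u \<otimes> ?\<delta> x \<otimes> w"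
      unfolding degeneracy_def by (rule act_at_inside_full[OF \<delta> u x w n(1) i'])
    have 1: "S (Suc n) i (u \<otimes> ?\<delta> x \<otimes> w) = u \<otimes> \<sigma> (?\<delta> x) \<otimes> w"
      by (rule act_at_inside_full[OF lin_sigma u lin_in[OF \<delta> x] w n(2) i'])
    have "\<sigma> (?\<delta> x) = ?\<delta> x"
    proof (rule lin_eqI[OF lin_comp[OF \<delta> lin_sigma] \<delta> _ x])
      fix xs :: "'v list" assume "length xs = 1"
      then obtain v where "xs = [v]" by (auto simp: length_Suc_conv)
      then show "\<sigma> (?\<delta> (P xs)) = ?\<delta> (P xs)"
        using \<Delta> cocomm by (simp add: coassociative_def sigma_cocommutative_def comult_map_pure)
    qed
    then show "S (Suc n) i (degeneracy scale \<Delta> n i (u \<otimes> x \<otimes> w)) =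
        degeneracy scale \<Delta> n i (u \<otimes> x \<otimes> w)"
      by (simp only: 0 1)
  qed
qed

text \<open>
  The choice \<open>a = 1\<close>, \<open>b = 2\<close> is the compatibility of a comultiplication with a strand crossing
  from right to left, and \<open>a = 2\<close>, \<open>b = 1\<close> is the other one; here either is moved to an
  arbitrary place.
\<close>

lemma act_at_crossing:
  assumes \<phi>: "lin 1 2 \<phi>" and ab: "{a, b} = {1, 2}"
    and cross: "\<And>x. x \<in> W 2 \<Longrightarrow>
      act_at scale 1 2 b \<phi> (\<sigma> x) = S 3 a (S 3 b (act_at scale 1 2 a \<phi> x))"
    and p: "p + 2 \<le> n" and t: "t \<in> W n"
  shows "act_at scale 1 n (p + b) \<phi> (S n (p + 1) t) =
    S (Suc n) (p + a) (S (Suc n) (p + b) (act_at scale 1 n (p + a) \<phi> t))"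
proof -
  define q where "q = n - (p + 2)"
  have n: "n = p + (2 + q)" "Suc n = p + (3 + q)"
    using p by (simp_all add: q_def)
  have a: "1 \<le> a" "a \<le> 2" and b: "1 \<le> b" "b \<le> 2"
    using ab by (auto simp: doubleton_eq_iff)
  have lS: "lin n n (S n (p + 1))" "lin (Suc n) (Suc n) (S (Suc n) (p + a))"
      "lin (Suc n) (Suc n) (S (Suc n) (p + b))"
    using p a b by (simp_all add: lin_S)
  have l\<phi>: "lin n (Suc n) (act_at scale 1 n (p + a) \<phi>)" "lin n (Suc n) (act_at scale 1 n (p + b) \<phi>)"
      "lin 2 3 (act_at scale 1 2 a \<phi>)"
    by (rule lin_act[OF \<phi>]; use p a b in simp)+
  show ?thesis
  proof (rule lin_eqI3[OF n(1) lin_comp[OF lS(1) l\<phi>(2)]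
        lin_comp[OF lin_comp[OF l\<phi>(1) lS(3)] lS(2)] _ t])
    fix u x w assume u: "u \<in> W p" and x: "x \<in> W 2" and w: "w \<in> W q"
    have 1: "S n (p + 1) (u \<otimes> x \<otimes> w) = u \<otimes> \<sigma> x \<otimes> w"
      by (rule act_at_inside_full[OF lin_sigma u x w n(1) refl])
    have 2: "act_at scale 1 n (p + c) \<phi> (u \<otimes> y \<otimes> w) = u \<otimes> act_at scale 1 2 c \<phi> y \<otimes> w"
      if "y \<in> W 2" "1 \<le> c" "c \<le> 2" for y c
      by (rule act_at_inside[OF \<phi> _ _ u that(1) w n(1) refl]) (use that in simp_all)
    have 3: "S (Suc n) (p + c) (u \<otimes> y \<otimes> w) = u \<otimes> S 3 c y \<otimes> w"
      if "y \<in> W 3" "1 \<le> c" "c \<le> 2" for y c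
      by (rule act_at_inside[OF lin_sigma _ _ u that(1) w n(2) refl]) (use that in simp_all)
    have y: "act_at scale 1 2 a \<phi> x \<in> W 3" by (rule lin_in[OF l\<phi>(3) x])
    have z: "S 3 b (act_at scale 1 2 a \<phi> x) \<in> W 3" using y b by (simp add: S_in)
    show "act_at scale 1 n (p + b) \<phi> (S n (p + 1) (u \<otimes> x \<otimes> w)) =
        S (Suc n) (p + a) (S (Suc n) (p + b) (act_at scale 1 n (p + a) \<phi> (u \<otimes> x \<otimes> w)))"
      unfolding 1 2[OF lin_in[OF lin_sigma x] b] 2[OF x a] 3[OF y b] 3[OF z a] cross[OF x] ..
  qed
qed

text \<open>
  The index of the pulled strand exceeds by one on the left-hand side, because the comultiplication
  on its left has added a factor.
\<close>

lemma L_past_degeneracy: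
  assumes \<epsilon>: "form \<epsilon>" and \<Delta>: "semi_pre_braided_coalgebra scale \<sigma> \<Delta>"
    and j: "1 \<le> j" "j < i" "i \<le> Suc n" and t: "t \<in> W (Suc n)"
  shows "L \<epsilon> (Suc (Suc n)) (Suc i) (degeneracy scale \<Delta> (Suc n) j t) =
    degeneracy scale \<Delta> n j (L \<epsilon> (Suc n) i t)"
proof -
  let ?N = "Suc (Suc n)" and ?\<delta> = "comult_map \<Delta>"
  have \<delta>: "lin 1 2 ?\<delta>"
    using \<Delta> by (intro lin_comult) (simp add: semi_pre_braided_coalgebra_def)
  have past: "act_at scale 1 (Suc n) (Suc j) ?\<delta> (S (Suc n) j t) =
      S ?N j (S ?N (Suc j) (act_at scale 1 (Suc n) j ?\<delta> t))" if "t \<in> W (Suc n)" for t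
    using act_at_crossing[OF \<delta>, of 1 2 "j - 1" "Suc n" t] \<Delta> j that
    by (simp add: semi_pre_braided_coalgebra_def)
  have "L \<epsilon> ?N (j + 2) (act_at scale 1 (Suc n) j ?\<delta> t) =
      act_at scale 1 n j ?\<delta> (L \<epsilon> (Suc n) (j + 1) t)" if t: "t \<in> W (Suc n)" for t
  proof -
    have "L \<epsilon> ?N (j + 2) (act_at scale 1 (Suc n) j ?\<delta> t) =
        L \<epsilon> ?N j (S ?N j (S ?N (Suc j) (act_at scale 1 (Suc n) j ?\<delta> t)))"
      using j by (simp add: L_Suc)
    also have "\<dots> = L \<epsilon> ?N j (act_at scale 1 (Suc n) (Suc j) ?\<delta> (S (Suc n) j t))"
      by (simp only: past[OF t])
    also have "\<dots> = act_at scale 1 n j ?\<delta> (L \<epsilon> (Suc n) j (S (Suc n) j t))"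
      by (rule L_natural[OF \<epsilon> \<delta>]) (use j t in \<open>simp_all add: S_in\<close>)
    also have "\<dots> = act_at scale 1 n j ?\<delta> (L \<epsilon> (Suc n) (j + 1) t)"
      using j by (simp add: L_Suc)
    finally show ?thesis .
  qed
  note past_j = this
  have "j + 1 + (i - (j + 1)) = i" "j + 2 + (i - (j + 1)) = Suc i" using j by simp_all
  then show ?thesis
    using L_past[OF \<delta> j(1) _ past_j _ t, of "i - (j + 1)"] j
    by (simp add: degeneracy_def)
qed

lemma R_past_degeneracy:
  assumes \<zeta>: "form \<zeta>" and \<Delta>: "pre_braided_coalgebra scale \<sigma> \<Delta>"
    and i: "1 \<le> i" "i \<le> j" "j \<le> n" and t: "t \<in> W (Suc n)"
  shows "R \<zeta> (Suc (Suc n)) i (degeneracy scale \<Delta> (Suc n) (Suc j) t) =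
    degeneracy scale \<Delta> n j (R \<zeta> (Suc n) i t)"
  unfolding degeneracy_def
proof (rule R_past[OF _ i(1,2) _ _ _ t])
  let ?N = "Suc (Suc n)" and ?\<delta> = "comult_map \<Delta>"
  show \<delta>: "lin 1 2 ?\<delta>"
    using \<Delta> by (intro lin_comult) (simp add: pre_braided_coalgebra_def semi_pre_braided_coalgebra_def)
  fix t assume t: "t \<in> W (Suc n)"
  have past: "act_at scale 1 (Suc n) j ?\<delta> (S (Suc n) j t) =
      S ?N (Suc j) (S ?N j (act_at scale 1 (Suc n) (Suc j) ?\<delta> t))"
    using act_at_crossing[OF \<delta>, of 2 1 "j - 1" "Suc n" t] \<Delta> i t
    by (simp add: pre_braided_coalgebra_def insert_commute)
  have "R \<zeta> ?N j (act_at scale 1 (Suc n) (Suc j) ?\<delta> t) =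
      R \<zeta> ?N (j + 2) (S ?N (Suc j) (S ?N j (act_at scale 1 (Suc n) (Suc j) ?\<delta> t)))"
    using i by (simp add: R_Suc)
  also have "\<dots> = R \<zeta> ?N (j + 2) (act_at scale 1 (Suc n) j ?\<delta> (S (Suc n) j t))"
    by (simp only: past)
  also have "\<dots> = act_at scale 1 n j ?\<delta> (R \<zeta> (Suc n) (Suc j) (S (Suc n) j t))"
    by (rule R_natural[OF \<zeta> \<delta>]) (use i t in \<open>simp_all add: S_in\<close>)
  also have "\<dots> = act_at scale 1 n j ?\<delta> (R \<zeta> (Suc n) j t)"
    using i by (simp add: R_Suc)
  finally show "R \<zeta> ?N j (act_at scale 1 (Suc n) (Suc j) ?\<delta> t) =
      act_at scale 1 n j ?\<delta> (R \<zeta> (Suc n) j t)" .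
qed (use i in simp_all)


section \<open>Signed sums of faces and quantum shuffles\<close>

lemma act_at_tscale:
  assumes \<phi>: "lin l r \<phi>" and i: "1 \<le> i" "i + l \<le> n + 1" and t: "t \<in> W n"
  shows "act_at scale l n i (\<lambda>x. tscale c (\<phi> x)) t = tscale c (act_at scale l n i \<phi> t)"
proof -
  define p q where "p = i - 1" and "q = n + 1 - (i + l)"
  have n: "n = p + (l + q)" and i': "i = p + 1"
    using i by (simp_all add: p_def q_def)
  have l: "lin n (n - l + r) (act_at scale l n i \<psi>)" if "lin l r \<psi>" for \<psi>
    by (rule lin_act[OF that i]) (use i in simp)
  note c\<phi> = lin_tscale[OF \<phi>, of c]
  show ?thesis
  proof (rule lin_eqI3[OF n l[OF c\<phi>] lin_tscale[OF l[OF \<phi>]] _ t])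
    fix u x w assume u: "u \<in> W p" and x: "x \<in> W l" and w: "w \<in> W q"
    have y: "\<phi> x \<otimes> w \<in> W (r + q)"
      by (rule tprod_in_tpow[OF V lin_in[OF \<phi> x] w])
    show "act_at scale l n i (\<lambda>x. tscale c (\<phi> x)) (u \<otimes> x \<otimes> w) =
        tscale c (act_at scale l n i \<phi> (u \<otimes> x \<otimes> w))"
      unfolding act_at_inside_full[OF c\<phi> u x w n i'] act_at_inside_full[OF \<phi> u x w n i']
        tprod_scale_left tprod_linear_right(2)[OF V u y y] ..
  qed
qed

lemma act_at_uminus_S:
  assumes "1 \<le> i" "i < n" "t \<in> W n"
  shows "act_at scale 2 n i (- \<sigma>) t = tscale (- 1) (S n i t)"
proof -
  have "- \<sigma> = (\<lambda>x. tscale (- 1) (\<sigma> x))"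
    by (rule ext) (simp add: T.scale_minus_left)
  then show ?thesis
    using act_at_tscale[OF lin_sigma assms(1) _ assms(3)] assms(2) by (simp only:)
qed

lemma lin_T_perm_to_left:
  assumes "1 \<le> i" "i \<le> n"
  shows "lin n n (T_perm scale \<sigma> n (to_left i))"
  using assms
proof (induction i rule: dec_induct)
  case base
  then show ?case
    using T_perm_to_left_1[of n scale \<sigma>] by (simp add: linear_between_def)
next
  case (step i)
  then show ?case
    using lin_comp[OF lin_S step.IH] by (simp add: T_perm_to_left_Suc comp_def)
qed

lemma lin_T_perm_to_right:
  assumes "1 \<le> i" "i \<le> n"
  shows "lin n n (T_perm scale \<sigma> n (to_right n i))"
  using assms(2,1)
proof (induction i rule: inc_induct)
  case base
  then show ?case
    by (simp add: T_perm_to_right_n linear_between_def)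
next
  case (step i)
  then show ?case
    using lin_comp[OF lin_S step.IH] by (simp add: T_perm_to_right_Suc comp_def)
qed

lemma T_perm_uminus_to_left:
  assumes "1 \<le> i" "i \<le> n" "t \<in> W n"
  shows "T_perm scale (- \<sigma>) n (to_left i) t = tscale ((- 1) ^ (i - 1)) (T_perm scale \<sigma> n (to_left i) t)"
  using assms
proof (induction i arbitrary: t rule: dec_induct)
  case base
  then show ?case
    by (simp only: T_perm_to_left_1) simp
next
  case (step i)
  let ?T = "T_perm scale \<sigma> n (to_left i)"
  have St: "S n i t \<in> W n" by (rule S_in) (use step in simp_all)
  have "act_at scale 2 n i (- \<sigma>) t = tscale (- 1) (S n i t)"
    by (rule act_at_uminus_S) (use step in simp_all)
  then have "T_perm scale (- \<sigma>) n (to_left (Suc i)) t =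
      T_perm scale (- \<sigma>) n (to_left i) (tscale (- 1) (S n i t))"
    using step.hyps step.prems(1) by (simp only: T_perm_to_left_Suc Suc_le_eq comp_apply)
  also have "\<dots> = tscale ((- 1) ^ (i - 1)) (?T (tscale (- 1) (S n i t)))"
    by (rule step.IH[OF _ T.subspace_scale[OF subspace_tpow St]]) (use step.hyps step.prems in simp)
  also have "?T (tscale (- 1) (S n i t)) = tscale (- 1) (?T (S n i t))"
    by (rule lin_scaleD[OF lin_T_perm_to_left St]) (use step.hyps step.prems(1) in simp_all)
  also have "?T (S n i t) = T_perm scale \<sigma> n (to_left (Suc i)) t"
    using step by (simp add: T_perm_to_left_Suc)
  also have "tscale ((- 1) ^ (i - 1)) (tscale (- 1) (T_perm scale \<sigma> n (to_left (Suc i)) t)) =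
      tscale ((- 1) ^ (Suc i - 1)) (T_perm scale \<sigma> n (to_left (Suc i)) t)"
    using step.hyps by (cases i) simp_all
  finally show ?case .
qed

lemma T_perm_uminus_to_right:
  assumes "1 \<le> i" "i \<le> n" "t \<in> W n"
  shows "T_perm scale (- \<sigma>) n (to_right n i) t = tscale ((- 1) ^ (n - i)) (T_perm scale \<sigma> n (to_right n i) t)"
  using assms(2,1,3)
proof (induction i arbitrary: t rule: inc_induct)
  case base
  then show ?case
    by (simp add: T_perm_to_right_n)
next
  case (step i)
  let ?T = "T_perm scale \<sigma> n (to_right n (Suc i))"
  have St: "S n i t \<in> W n" by (rule S_in) (use step in simp_all)
  have "act_at scale 2 n i (- \<sigma>) t = tscale (- 1) (S n i t)"
    by (rule act_at_uminus_S) (use step in simp_all)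
  then have "T_perm scale (- \<sigma>) n (to_right n i) t =
      T_perm scale (- \<sigma>) n (to_right n (Suc i)) (tscale (- 1) (S n i t))"
    using step.hyps step.prems(1) by (simp only: T_perm_to_right_Suc comp_apply)
  also have "\<dots> = tscale ((- 1) ^ (n - Suc i)) (?T (tscale (- 1) (S n i t)))"
    by (rule step.IH[OF _ T.subspace_scale[OF subspace_tpow St]]) (use step.hyps step.prems in simp)
  also have "?T (tscale (- 1) (S n i t)) = tscale (- 1) (?T (S n i t))"
    by (rule lin_scaleD[OF lin_T_perm_to_right St]) (use step.hyps in simp_all)
  also have "?T (S n i t) = T_perm scale \<sigma> n (to_right n i) t"
    using step by (simp add: T_perm_to_right_Suc)
  also have "tscale ((- 1) ^ (n - Suc i)) (tscale (- 1) (T_perm scale \<sigma> n (to_right n i) t)) =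
      tscale ((- 1) ^ (n - i)) (T_perm scale \<sigma> n (to_right n i) t)"
    using step.hyps by (simp add: Suc_diff_Suc[symmetric])
  finally show ?case .
qed

lemma act_at_sum:
  "act_at scale l n i \<phi> (\<Sum>a\<in>A. tscale (c a) (f a)) = (\<Sum>a\<in>A. tscale (c a) (act_at scale l n i \<phi> (f a)))"
proof -
  interpret TT: vector_space_pair "tscale :: 'k \<Rightarrow> ('k, 'v) tensor \<Rightarrow> _" "tscale :: 'k \<Rightarrow> ('k, 'v) tensor \<Rightarrow> _" ..
  have l: "Vector_Spaces.linear tscale tscale (act_at scale l n i \<phi>)"
    unfolding act_at_def by (rule linear_tlift)
  show ?thesis
    by (simp add: TT.linear_sum[OF l] TT.linear_scale[OF l])
qed

lemma left_differential:
  assumes t: "t \<in> W n" and n: "1 \<le> n"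
  shows "(\<Sum>i=1..n. tscale ((-1) ^ (i - 1)) (L \<epsilon> n i t)) =
    apply_form \<epsilon> n 1 (csh scale (- \<sigma>) 1 (n - 1) t)"
proof -
  obtain m where m: "n = Suc m" using n by (cases n) auto
  have "csh scale (- \<sigma>) 1 (n - 1) t = (\<Sum>i=1..n. T_perm scale (- \<sigma>) n (to_left i) t)"
    using sum_Sh_left[of "\<lambda>s. T_perm scale (- \<sigma>) n s t" m] by (simp add: csh_def m)
  also have "\<dots> = (\<Sum>i=1..n. tscale ((-1) ^ (i - 1)) (T_perm scale \<sigma> n (to_left i) t))"
    by (intro sum.cong refl T_perm_uminus_to_left t) simp_all
  finally show ?thesis
    by (simp only: act_at_sum left_face_def comp_apply)
qed

text \<open>
  The cycle takes \<open>n - i\<close> crossings, and \<open>(n - 1) + (n - i)\<close> has the parity of \<open>i - 1\<close>.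
\<close>

lemma right_differential:
  assumes t: "t \<in> W n" and n: "1 \<le> n"
  shows "(\<Sum>i=1..n. tscale ((-1) ^ (i - 1)) (R \<zeta> n i t)) =
    tscale ((-1) ^ (n - 1)) (apply_form \<zeta> n n (csh scale (- \<sigma>) (n - 1) 1 t))"
proof -
  obtain m where m: "n = Suc m" using n by (cases n) auto
  have "csh scale (- \<sigma>) (n - 1) 1 t = (\<Sum>i=1..n. T_perm scale (- \<sigma>) n (to_right n i) t)"
    using sum_Sh_right[of "\<lambda>s. T_perm scale (- \<sigma>) n s t" m] by (simp add: csh_def m)
  also have "\<dots> = (\<Sum>i=1..n. tscale ((-1) ^ (n - i)) (T_perm scale \<sigma> n (to_right n i) t))"
    by (intro sum.cong refl T_perm_uminus_to_right t) simp_all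
  finally have "tscale ((-1) ^ (n - 1)) (apply_form \<zeta> n n (csh scale (- \<sigma>) (n - 1) 1 t)) =
      (\<Sum>i=1..n. tscale ((-1) ^ (n - 1) * (-1) ^ (n - i)) (R \<zeta> n i t))"
    by (simp only: act_at_sum right_face_def comp_apply T.scale_sum_right T.scale_scale)
  also have "\<dots> = (\<Sum>i=1..n. tscale ((-1) ^ (i - 1)) (R \<zeta> n i t))"
  proof (intro sum.cong refl)
    fix i assume "i \<in> {1..n}"
    then have "n - 1 + (n - i) = (i - 1) + 2 * (n - i)" by auto
    then have "(-1) ^ (n - 1) * (-1) ^ (n - i) = ((-1) ^ (i - 1) :: 'k)"
      by (simp add: power_add[symmetric]) (simp add: power_add power_mult)
    then show "tscale ((-1) ^ (n - 1) * (-1) ^ (n - i)) (R \<zeta> n i t) = tscale ((-1) ^ (i - 1)) (R \<zeta> n i t)"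
      by simp
  qed
  finally show ?thesis by (rule sym)
qed


section \<open>Simplicial structures\<close>

lemma two_face_indices:
  fixes i j n :: nat
  assumes "1 \<le> i" "i < j" "j \<le> n"
  obtains m k where "n = Suc (Suc m)" "j = Suc k" "i \<le> k" "k \<le> Suc m"
  using assms that[of "n - 2" "j - 1"] by auto

text \<open>
  The indices are shifted so that the source \<open>V\<^sub>n\<close> is written with its predecessors: identities
  between two faces concern \<open>n \<ge> 2\<close> only, and \<open>j \<ge> 2\<close> there.
\<close>

lemma presimplicialI:
  assumes "\<And>n i. 1 \<le> i \<Longrightarrow> i \<le> Suc n \<Longrightarrow> lin (Suc n) n (d (Suc n) i)"
    and "\<And>n i j t. 1 \<le> i \<Longrightarrow> i \<le> j \<Longrightarrow> j \<le> Suc n \<Longrightarrow> t \<in> W (Suc (Suc n)) \<Longrightarrow>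
      d (Suc n) i (d (Suc (Suc n)) (Suc j) t) = d (Suc n) j (d (Suc (Suc n)) i t)"
  shows "presimplicial tscale W d"
  unfolding presimplicial_def
proof (intro conjI allI ballI impI vector_space_tscale subspace_tpow)
  fix n i :: nat assume i: "1 \<le> i \<and> i \<le> n"
  then obtain m where "n = Suc m" by (cases n) auto
  then show "lin n (n - 1) (d n i)"
    using assms(1)[of i m] i by simp
next
  fix n i j t assume t: "t \<in> W n" and ij: "1 \<le> i \<and> i < j \<and> j \<le> n"
  from ij obtain m k where "n = Suc (Suc m)" "j = Suc k" "i \<le> k" "k \<le> Suc m"
    using two_face_indices by metis
  then show "d (n - 1) i (d n j t) = d (n - 1) (j - 1) (d n i t)"
    using assms(2)[of i k m t] t ij by simp
qed

lemma pre_bisimplicialI: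
  assumes "presimplicial tscale W d" "presimplicial tscale W d'"
    and "\<And>n i j t. 1 \<le> i \<Longrightarrow> i \<le> j \<Longrightarrow> j \<le> Suc n \<Longrightarrow> t \<in> W (Suc (Suc n)) \<Longrightarrow>
      d (Suc n) i (d' (Suc (Suc n)) (Suc j) t) = d' (Suc n) j (d (Suc (Suc n)) i t)"
    and "\<And>n i j t. 1 \<le> i \<Longrightarrow> i \<le> j \<Longrightarrow> j \<le> Suc n \<Longrightarrow> t \<in> W (Suc (Suc n)) \<Longrightarrow>
      d' (Suc n) i (d (Suc (Suc n)) (Suc j) t) = d (Suc n) j (d' (Suc (Suc n)) i t)"
  shows "pre_bisimplicial tscale W d d'"
  unfolding pre_bisimplicial_def
proof (intro conjI[OF assms(1)] conjI[OF assms(2)] allI ballI impI)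
  fix n i j t assume t: "t \<in> W n" and ij: "1 \<le> i \<and> i < j \<and> j \<le> n"
  from ij obtain m k where "n = Suc (Suc m)" "j = Suc k" "i \<le> k" "k \<le> Suc m"
    using two_face_indices by metis
  then show "d (n - 1) i (d' n j t) = d' (n - 1) (j - 1) (d n i t) \<and>
      d' (n - 1) i (d n j t) = d (n - 1) (j - 1) (d' n i t)"
    using assms(3)[of i k m t] assms(4)[of i k m t] t ij by simp
qed

text \<open>
  The relations between degeneracies hold for any coassociative comultiplication: for \<open>i < j\<close> they
  act on different factors.  What remains to be checked for a family of faces is that these commute
  with a comultiplication on either side of the index.
\<close>

lemma very_weakly_simplicial_degeneracyI:
  assumes d: "presimplicial tscale W d" and \<Delta>: "coassociative scale \<Delta>"
    and right: "\<And>n i j t. 1 \<le> i \<Longrightarrow> i \<le> j \<Longrightarrow> j \<le> n \<Longrightarrow> t \<in> W (Suc n) \<Longrightarrow>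
      d (Suc (Suc n)) i (degeneracy scale \<Delta> (Suc n) (Suc j) t) = degeneracy scale \<Delta> n j (d (Suc n) i t)"
    and left: "\<And>n i j t. 1 \<le> j \<Longrightarrow> j < i \<Longrightarrow> i \<le> Suc n \<Longrightarrow> t \<in> W (Suc n) \<Longrightarrow>
      d (Suc (Suc n)) (Suc i) (degeneracy scale \<Delta> (Suc n) j t) = degeneracy scale \<Delta> n j (d (Suc n) i t)"
  shows "very_weakly_simplicial tscale W d (degeneracy scale \<Delta>)"
  unfolding very_weakly_simplicial_def
proof (intro conjI allI ballI impI d; (elim conjE)?)
  note \<delta> = lin_comult[OF \<Delta>]
  fix n i :: nat assume "1 \<le> i" "i \<le> n"
  then show "lin n (n + 1) (degeneracy scale \<Delta> n i)"
    unfolding degeneracy_def by (intro lin_act[OF \<delta>]) simp_all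
next
  fix n i j t assume t: "t \<in> W n" and ij: "1 \<le> i" "i \<le> j" "j \<le> n"
  show "degeneracy scale \<Delta> (n + 1) i (degeneracy scale \<Delta> n j t) =
      degeneracy scale \<Delta> (n + 1) (j + 1) (degeneracy scale \<Delta> n i t)"
  proof (cases "i = j")
    case True
    then show ?thesis using coassociative_at[OF \<Delta>, of i n t] t ij by simp
  next
    case False
    show ?thesis
      unfolding degeneracy_def
      by (rule act_at_commute[OF lin_comult[OF \<Delta>] lin_comult[OF \<Delta>]]) (use False ij t in simp_all)
  qed
next
  fix n i j t assume t: "t \<in> W n" and ij: "1 \<le> i" "i < j" "j \<le> n"
  then obtain m k where "n = Suc m" "j = Suc k" by (cases n; cases j) auto
  then show "d (n + 1) i (degeneracy scale \<Delta> n j t) = degeneracy scale \<Delta> (n - 1) (j - 1) (d n i t)"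
    using right[of i k m t] t ij by simp
next
  fix n i j t assume t: "t \<in> W n" and ij: "1 \<le> j" "j + 1 < i" "i \<le> n + 1"
  then obtain m k where "n = Suc m" "i = Suc k" by (cases n; cases i) auto
  then show "d (n + 1) i (degeneracy scale \<Delta> n j t) = degeneracy scale \<Delta> (n - 1) j (d n (i - 1) t)"
    using left[of j k m t] t ij by simp
qed

lemma presimplicial_L:
  assumes "braided_character scale \<sigma> \<epsilon>"
  shows "presimplicial tscale W (L \<epsilon>)"
  using assms by (intro presimplicialI lin_L L_L) (simp_all add: braided_character_def)

lemma presimplicial_R:
  assumes "braided_character scale \<sigma> \<zeta>"
  shows "presimplicial tscale W (R \<zeta>)"
  using assms by (intro presimplicialI lin_R R_R) (simp_all add: braided_character_def)

lemma pre_bisimplicial_L_R: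
  assumes "braided_character scale \<sigma> \<epsilon>" "braided_character scale \<sigma> \<zeta>"
  shows "pre_bisimplicial tscale W (L \<epsilon>) (R \<zeta>)"
  using assms
  by (intro pre_bisimplicialI presimplicial_L presimplicial_R L_R R_L)
    (simp_all add: braided_character_def)

lemma pre_bisimplicial_L_L:
  assumes "braided_character scale \<sigma> \<epsilon>" "braided_character scale \<sigma> \<zeta>"
    and "sigma_compatible scale \<sigma> \<epsilon> \<zeta>"
  shows "pre_bisimplicial tscale W (L \<epsilon>) (L \<zeta>)"
  using assms
  by (intro pre_bisimplicialI presimplicial_L L_L)
    (simp_all add: braided_character_def sigma_compatible_def)

lemma very_weakly_simplicial_L:
  assumes \<epsilon>: "braided_character scale \<sigma> \<epsilon>" and \<Delta>: "semi_pre_braided_coalgebra scale \<sigma> \<Delta>"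
  shows "very_weakly_simplicial tscale W (L \<epsilon>) (degeneracy scale \<Delta>)"
proof (rule very_weakly_simplicial_degeneracyI[OF presimplicial_L[OF \<epsilon>]])
  show co: "coassociative scale \<Delta>" using \<Delta> by (simp add: semi_pre_braided_coalgebra_def)
  have \<epsilon>': "form \<epsilon>" using \<epsilon> by (simp add: braided_character_def)
  fix n i j t assume t: "t \<in> W (Suc n)"
  show "L \<epsilon> (Suc (Suc n)) i (degeneracy scale \<Delta> (Suc n) (Suc j) t) = degeneracy scale \<Delta> n j (L \<epsilon> (Suc n) i t)"
    if "1 \<le> i" "i \<le> j" "j \<le> n"
    unfolding degeneracy_def
    by (rule L_natural[OF \<epsilon>' lin_comult[OF co]]) (use that t in simp_all)
  show "L \<epsilon> (Suc (Suc n)) (Suc i) (degeneracy scale \<Delta> (Suc n) j t) = degeneracy scale \<Delta> n j (L \<epsilon> (Suc n) i t)"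
    if "1 \<le> j" "j < i" "i \<le> Suc n"
    by (rule L_past_degeneracy[OF \<epsilon>' \<Delta> that t])
qed

lemma very_weakly_simplicial_R:
  assumes \<zeta>: "braided_character scale \<sigma> \<zeta>" and \<Delta>: "pre_braided_coalgebra scale \<sigma> \<Delta>"
  shows "very_weakly_simplicial tscale W (R \<zeta>) (degeneracy scale \<Delta>)"
proof (rule very_weakly_simplicial_degeneracyI[OF presimplicial_R[OF \<zeta>]])
  show co: "coassociative scale \<Delta>"
    using \<Delta> by (simp add: pre_braided_coalgebra_def semi_pre_braided_coalgebra_def)
  have \<zeta>': "form \<zeta>" using \<zeta> by (simp add: braided_character_def)
  fix n i j t assume t: "t \<in> W (Suc n)"
  show "R \<zeta> (Suc (Suc n)) i (degeneracy scale \<Delta> (Suc n) (Suc j) t) = degeneracy scale \<Delta> n j (R \<zeta> (Suc n) i t)"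
    if "1 \<le> i" "i \<le> j" "j \<le> n"
    by (rule R_past_degeneracy[OF \<zeta>' \<Delta> that t])
  show "R \<zeta> (Suc (Suc n)) (Suc i) (degeneracy scale \<Delta> (Suc n) j t) = degeneracy scale \<Delta> n j (R \<zeta> (Suc n) i t)"
    if "1 \<le> j" "j < i" "i \<le> Suc n"
    unfolding degeneracy_def
    by (rule R_natural[OF \<zeta>' lin_comult[OF co]]) (use that t in simp_all)
qed

lemma weakly_simplicial_L:
  assumes "braided_character scale \<sigma> \<epsilon>" and \<Delta>: "semi_pre_braided_coalgebra scale \<sigma> \<Delta>"
    and cocomm: "sigma_cocommutative \<sigma> \<Delta>"
  shows "weakly_simplicial tscale W (L \<epsilon>) (degeneracy scale \<Delta>)"
  unfolding weakly_simplicial_def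
proof (intro conjI allI ballI impI very_weakly_simplicial_L assms(1) \<Delta>)
  fix n i t assume t: "t \<in> W n" and i: "1 \<le> i \<and> i \<le> n"
  have "coassociative scale \<Delta>" using \<Delta> by (simp add: semi_pre_braided_coalgebra_def)
  then show "L \<epsilon> (n + 1) i (degeneracy scale \<Delta> n i t) = L \<epsilon> (n + 1) (i + 1) (degeneracy scale \<Delta> n i t)"
    using i t by (simp add: L_Suc cocommutative_at cocomm)
qed

lemma weakly_simplicial_R:
  assumes "braided_character scale \<sigma> \<zeta>" and \<Delta>: "pre_braided_coalgebra scale \<sigma> \<Delta>"
    and cocomm: "sigma_cocommutative \<sigma> \<Delta>"
  shows "weakly_simplicial tscale W (R \<zeta>) (degeneracy scale \<Delta>)"
  unfolding weakly_simplicial_def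
proof (intro conjI allI ballI impI very_weakly_simplicial_R assms(1) \<Delta>)
  fix n i t assume t: "t \<in> W n" and i: "1 \<le> i \<and> i \<le> n"
  have "coassociative scale \<Delta>"
    using \<Delta> by (simp add: pre_braided_coalgebra_def semi_pre_braided_coalgebra_def)
  then show "R \<zeta> (n + 1) i (degeneracy scale \<Delta> n i t) = R \<zeta> (n + 1) (i + 1) (degeneracy scale \<Delta> n i t)"
    using i t by (simp add: R_Suc[of i "Suc n"] cocommutative_at cocomm)
qed

end

theorem theorem3:
  fixes scale :: "'k::field \<Rightarrow> 'v::ab_group_add \<Rightarrow> 'v"
    and \<sigma> :: "('k, 'v) tensor \<Rightarrow> ('k, 'v) tensor"
  assumes "vector_space scale" and "pre_braiding scale \<sigma>"
  shows
    "(\<forall>\<epsilon> \<zeta>. braided_character scale \<sigma> \<epsilon> \<and> braided_character scale \<sigma> \<zeta> \<longrightarrow>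
        pre_bisimplicial tscale (tpow scale) (left_face scale \<sigma> \<epsilon>) (right_face scale \<sigma> \<zeta>))
    \<and>
    (\<forall>\<epsilon> \<zeta>. braided_character scale \<sigma> \<epsilon> \<and> braided_character scale \<sigma> \<zeta> \<longrightarrow>
        (\<forall>n\<ge>1. \<forall>t\<in>tpow scale n.
          (\<Sum>i=1..n. tscale ((-1) ^ (i - 1)) (left_face scale \<sigma> \<epsilon> n i t)) =
            act_at scale 1 n 1 (form_map scale \<epsilon>) (csh scale (- \<sigma>) 1 (n - 1) t) \<and>
          (\<Sum>i=1..n. tscale ((-1) ^ (i - 1)) (right_face scale \<sigma> \<zeta> n i t)) =
            tscale ((-1) ^ (n - 1))
              (act_at scale 1 n n (form_map scale \<zeta>) (csh scale (- \<sigma>) (n - 1) 1 t))))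
    \<and>
    (\<forall>\<epsilon> \<zeta>. braided_character scale \<sigma> \<epsilon> \<and> braided_character scale \<sigma> \<zeta> \<and>
          sigma_compatible scale \<sigma> \<epsilon> \<zeta> \<longrightarrow>
        pre_bisimplicial tscale (tpow scale) (left_face scale \<sigma> \<epsilon>) (left_face scale \<sigma> \<zeta>))
    \<and>
    (\<forall>\<epsilon> \<zeta> \<Delta>. braided_character scale \<sigma> \<epsilon> \<and> braided_character scale \<sigma> \<zeta> \<and>
          pre_braided_coalgebra scale \<sigma> \<Delta> \<longrightarrow>
        very_weakly_bisimplicial tscale (tpow scale)
          (left_face scale \<sigma> \<epsilon>) (right_face scale \<sigma> \<zeta>) (degeneracy scale \<Delta>) \<and>
        (sigma_compatible scale \<sigma> \<epsilon> \<zeta> \<longrightarrow>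
          very_weakly_bisimplicial tscale (tpow scale)
            (left_face scale \<sigma> \<epsilon>) (left_face scale \<sigma> \<zeta>) (degeneracy scale \<Delta>)))
    \<and>
    (\<forall>\<epsilon> \<Delta>. braided_character scale \<sigma> \<epsilon> \<and> semi_pre_braided_coalgebra scale \<sigma> \<Delta> \<longrightarrow>
        very_weakly_simplicial tscale (tpow scale) (left_face scale \<sigma> \<epsilon>) (degeneracy scale \<Delta>))
    \<and>
    (\<forall>\<epsilon> \<zeta> \<Delta>. braided_character scale \<sigma> \<epsilon> \<and> braided_character scale \<sigma> \<zeta> \<and>
          pre_braided_coalgebra scale \<sigma> \<Delta> \<and> sigma_cocommutative \<sigma> \<Delta> \<longrightarrow>
        weakly_bisimplicial tscale (tpow scale)
          (left_face scale \<sigma> \<epsilon>) (right_face scale \<sigma> \<zeta>) (degeneracy scale \<Delta>) \<and>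
        (sigma_compatible scale \<sigma> \<epsilon> \<zeta> \<longrightarrow>
          weakly_bisimplicial tscale (tpow scale)
            (left_face scale \<sigma> \<epsilon>) (left_face scale \<sigma> \<zeta>) (degeneracy scale \<Delta>)))
    \<and>
    (\<forall>\<epsilon> \<Delta>. braided_character scale \<sigma> \<epsilon> \<and>
          semi_pre_braided_coalgebra scale \<sigma> \<Delta> \<and> sigma_cocommutative \<sigma> \<Delta> \<longrightarrow>
        weakly_simplicial tscale (tpow scale) (left_face scale \<sigma> \<epsilon>) (degeneracy scale \<Delta>))"
proof -
  interpret pre_braided_space scale \<sigma>
    by (intro pre_braided_space.intro tensor_powers.intro pre_braided_space_axioms.intro assms)
  have semi: "pre_braided_coalgebra scale \<sigma> \<Delta> \<Longrightarrow> semi_pre_braided_coalgebra scale \<sigma> \<Delta>" for \<Delta>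
    by (simp add: pre_braided_coalgebra_def)
  show ?thesis
    unfolding very_weakly_bisimplicial_def weakly_bisimplicial_def
    using pre_bisimplicial_L_R pre_bisimplicial_L_L left_differential right_differential
      very_weakly_simplicial_L very_weakly_simplicial_R weakly_simplicial_L weakly_simplicial_R semi
    by (intro conjI allI impI ballI; elim conjE; (simp only:; fail))
qed

end
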